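(* Let $D$ be a weakly connected (finite or infinite) digraph. (a) If $\mathfrak{B}_{\mathrm{s\text{-}s}}$ is the set of all source-sink dicuts of $D$ of finite size and $\mathfrak{B}_{\mathrm{s\text{-}s}}\ne\emptyset$, then $D$ is $\mathfrak{B}_{\mathrm{s\text{-}s}}$-woodall. (b) If $c$ is a capacity of $D$, $\mathfrak{B}_{\mathrm{s\text{-}s}}$ is the set of all source-sink dicuts of $D$ of finite capacity, and $\mathfrak{B}_{\mathrm{s\text{-}s}}\ne\emptyset$, then $D$ is $\mathfrak{B}_{\mathrm{s\text{-}s}}$-woodall with respect to $c$.
   Context: Digraphs may have parallel edges, but no loops. $D$ is weakly connected if its underlying undirected multigraph is connected. For disjoint $X,Y$ with $X\cup Y=V(D)$, $E_D(X,Y)$ is the set of edges with one endvertex in $X$ and the other in $Y$. A cut is a set $B=E_D(X,Y)$ where $X,Y$ are non-empty, disjoint and have union $V(D)$. A dicut is a cut $B=E_D(X,Y)$ all of whose edges have their heads in the same one of the sides $X,Y$. In a weakly connected digraph every dicut is non-empty and its two sides are determined by it; the side containing the heads of the edges of $B$ is the in-shore $\mathrm{in}_D(B)$ and the side containing the tails is the out-shore $\mathrm{out}_D(B)$. An out-ray is a one-way infinite path $v_0v_1v_2\dots$ with all edges directed from $v_i$ to $v_{i+1}$; a back-ray is a one-way infinite path with all edges directed from $v_{i+1}$ to $v_i$. A strongly connected component $C$ of $D$ is a source component if no edge of $D$ has its head in $V(C)$ and its tail outside $V(C)$; it is a sink component if no edge of $D$ has its tail in $V(C)$ and its head outside $V(C)$.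 A dicut $B$ is sink-sided if $\mathrm{out}_D(B)$ contains neither a sink component nor an out-ray of $D$; it is source-sided if $\mathrm{in}_D(B)$ contains neither a source component nor a back-ray of $D$. A source-sink dicut is a dicut that is source-sided or sink-sided. For a non-empty set $\mathfrak{B}$ of dicuts, a $\mathfrak{B}$-dijoin is a set of edges meeting every element of $\mathfrak{B}$, and $D$ is $\mathfrak{B}$-woodall if the minimum size of an element of $\mathfrak{B}$ equals the maximum size of a set of pairwise disjoint $\mathfrak{B}$-dijoins. A capacity of $D$ is a map $c$ from $E(D)$ to a set of (finite or infinite) cardinals. For $A\subseteq E(D)$, $c(A)$ is the cardinal sum of the $c(e)$, $e\in A$; $A$ has finite capacity if $c(A)$ is finite. A family $(F_i)_{i\in I}$ of (not necessarily distinct) sets of edges is $c$-disjoint if every edge $e$ lies in $F_i$ for at most $c(e)$ indices $i\in I$; the size of the family is $|I|$. $D$ is $\mathfrak{B}$-woodall with respect to $c$ if the minimum of $c(B)$ over $B\in\mathfrak{B}$ equals the maximum size of a $c$-disjoint family of $\mathfrak{B}$-dijoins. *)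

theory Defs
  imports "Graph_Theory.Graph_Theory"
begin

unbundle cardinal_syntax

definition bipartition :: "('v,'e) pre_digraph \<Rightarrow> 'v set \<Rightarrow> 'v set \<Rightarrow> bool" where
  "bipartition D X Y \<longleftrightarrow> X \<noteq> {} \<and> Y \<noteq> {} \<and> X \<inter> Y = {} \<and> X \<union> Y = verts D"

definition edges_between :: "('v,'e) pre_digraph \<Rightarrow> 'v set \<Rightarrow> 'v set \<Rightarrow> 'e set" where
  "edges_between D X Y =
     {e \<in> arcs D. tail D e \<in> X \<and> head D e \<in> Y \<or> tail D e \<in> Y \<and> head D e \<in> X}"

definition dicut :: "('v,'e) pre_digraph \<Rightarrow> 'e set \<Rightarrow> bool" where
  "dicut D B \<longleftrightarrow> (\<exists>X Y. bipartition D X Y \<and> B = edges_between D X Y \<and>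
     ((\<forall>e\<in>B. head D e \<in> X) \<or> (\<forall>e\<in>B. head D e \<in> Y)))"

text \<open>The two shores are only meaningful for dicuts of weakly connected digraphs, where
  \<open>dicut_shores\<close> below shows that the descriptions are unique.\<close>

definition in_shore :: "('v,'e) pre_digraph \<Rightarrow> 'e set \<Rightarrow> 'v set" where
  "in_shore D B = (THE X. \<exists>Y. bipartition D X Y \<and> B = edges_between D X Y \<and>
     (\<forall>e\<in>B. head D e \<in> X))"

definition out_shore :: "('v,'e) pre_digraph \<Rightarrow> 'e set \<Rightarrow> 'v set" where
  "out_shore D B = (THE X. \<exists>Y. bipartition D X Y \<and> B = edges_between D X Y \<and>
     (\<forall>e\<in>B. tail D e \<in> X))"

lemma edges_between_commute: "edges_between D X Y = edges_between D Y X"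
  by (auto simp: edges_between_def)

lemma bipartition_commute: "bipartition D X Y \<longleftrightarrow> bipartition D Y X"
  by (auto simp: bipartition_def)

lemma edges_between_nonempty:
  assumes "connected D" and bp: "bipartition D X Y"
  shows "edges_between D X Y \<noteq> {}"
proof
  assume empty: "edges_between D X Y = {}"
  obtain x y where xy: "x \<in> X" "y \<in> Y" "y \<notin> X" "x \<in> verts D" "y \<in> verts D"
    using bp by (auto simp: bipartition_def)
  have "(x, y) \<in> rtrancl_on (verts D) (parcs (mk_symmetric D))"
    using assms(1) xy by (auto simp: connected_def strongly_connected_def reachable_def)
  then have "y \<in> X"
  proof (induction rule: rtrancl_on_induct)
    case base
    then show ?case using xy by simp
  next
    case (step u v)
    then obtain e where e: "e \<in> arcs D"
      "tail D e = u \<and> head D e = v \<or> tail D e = v \<and> head D e = u"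
      by (auto simp: parcs_mk_symmetric)
    have "v \<in> verts D" using step by auto
    then have "v \<in> X \<or> v \<in> Y" using bp by (auto simp: bipartition_def)
    then show ?case using e empty step by (auto simp: edges_between_def)
  qed
  with xy show False by simp
qed

lemma sides_unique:
  assumes con: "connected D"
    and bp: "bipartition D X Y" "bipartition D X' Y'"
    and eq: "edges_between D X Y = edges_between D X' Y'"
    and common: "X \<inter> X' \<noteq> {}"
  shows "X = X'"
proof (rule ccontr)
  assume "X \<noteq> X'"
  define S where "S = (X \<inter> X') \<union> (Y \<inter> Y')"
  define T where "T = (X \<inter> Y') \<union> (Y \<inter> X')"
  have "bipartition D S T"
    unfolding bipartition_def
  proof (intro conjI)
    show "S \<noteq> {}" using common by (auto simp: S_def)
    show "T \<noteq> {}"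
    proof
      assume "T = {}"
      then have "X \<inter> Y' = {}" "Y \<inter> X' = {}" by (auto simp: T_def)
      moreover have "X \<subseteq> X' \<union> Y'" "X' \<subseteq> X \<union> Y" using bp by (auto simp: bipartition_def)
      ultimately show False using \<open>X \<noteq> X'\<close> by blast
    qed
    show "S \<inter> T = {}" using bp by (auto simp: S_def T_def bipartition_def)
    have "v \<in> X \<or> v \<in> Y" "v \<in> X' \<or> v \<in> Y'" if "v \<in> verts D" for v
      using bp that by (auto simp: bipartition_def)
    moreover have "X \<subseteq> verts D" "Y \<subseteq> verts D"
      using bp by (auto simp: bipartition_def)
    ultimately show "S \<union> T = verts D" by (auto simp: S_def T_def)
  qed
  then obtain e where e: "e \<in> edges_between D S T"
    using edges_between_nonempty[OF con] by blast
  then have "(e \<in> edges_between D X Y) \<noteq> (e \<in> edges_between D X' Y')"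
  proof -
    have d: "\<And>v. v \<in> X \<Longrightarrow> v \<notin> Y" "\<And>v. v \<in> X' \<Longrightarrow> v \<notin> Y'"
      using bp by (auto simp: bipartition_def)
    show ?thesis using e d by (auto simp: S_def T_def edges_between_def)
  qed
  with eq show False by simp
qed

lemma dicut_shores:
  assumes con: "connected D"
    and bp: "bipartition D X Y" and B: "B = edges_between D X Y"
    and heads: "\<forall>e\<in>B. head D e \<in> Y"
  shows "in_shore D B = Y" and "out_shore D B = X"
proof -
  obtain e where e: "e \<in> B" using edges_between_nonempty[OF con bp] B by blast
  have tails: "\<forall>e\<in>B. tail D e \<in> X"
    using B heads bp by (auto simp: edges_between_def bipartition_def)
  show "in_shore D B = Y" unfolding in_shore_def
  proof (rule the_equality)
    show "\<exists>X. bipartition D Y X \<and> B = edges_between D Y X \<and> (\<forall>e\<in>B. head D e \<in> Y)"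
      using bp B heads bipartition_commute[of D X Y] edges_between_commute[of D X Y] by blast
  next
    fix Z assume "\<exists>W. bipartition D Z W \<and> B = edges_between D Z W \<and> (\<forall>e\<in>B. head D e \<in> Z)"
    then obtain W where W: "bipartition D Z W" "B = edges_between D Z W" "\<forall>e\<in>B. head D e \<in> Z"
      by blast
    have bp': "bipartition D Y X" "B = edges_between D Y X"
      using bp B bipartition_commute[of D X Y] edges_between_commute[of D X Y] by simp_all
    show "Z = Y"
      by (rule sides_unique[OF con W(1) bp'(1)]) (use W bp' e heads in auto)
  qed
  show "out_shore D B = X" unfolding out_shore_def
  proof (rule the_equality)
    show "\<exists>Y. bipartition D X Y \<and> B = edges_between D X Y \<and> (\<forall>e\<in>B. tail D e \<in> X)"
      using bp B tails by blast
  next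
    fix Z assume "\<exists>W. bipartition D Z W \<and> B = edges_between D Z W \<and> (\<forall>e\<in>B. tail D e \<in> Z)"
    then obtain W where W: "bipartition D Z W" "B = edges_between D Z W" "\<forall>e\<in>B. tail D e \<in> Z"
      by blast
    show "Z = X"
      by (rule sides_unique[OF con W(1) bp]) (use W B e tails in auto)
  qed
qed

text \<open>With parallel edges a ray is not determined by its vertices, but being contained in a side
  of a dicut depends only on them; so rays are given by their vertex sequences.\<close>

definition out_ray :: "('v,'e) pre_digraph \<Rightarrow> (nat \<Rightarrow> 'v) \<Rightarrow> bool" where
  "out_ray D r \<longleftrightarrow> inj r \<and> (\<forall>i. r i \<rightarrow>\<^bsub>D\<^esub> r (Suc i))"

definition back_ray :: "('v,'e) pre_digraph \<Rightarrow> (nat \<Rightarrow> 'v) \<Rightarrow> bool" where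
  "back_ray D r \<longleftrightarrow> inj r \<and> (\<forall>i. r (Suc i) \<rightarrow>\<^bsub>D\<^esub> r i)"

definition source_component :: "('v,'e) pre_digraph \<Rightarrow> ('v,'e) pre_digraph \<Rightarrow> bool" where
  "source_component D C \<longleftrightarrow> C \<in> pre_digraph.sccs D \<and>
     \<not> (\<exists>e\<in>arcs D. head D e \<in> verts C \<and> tail D e \<notin> verts C)"

definition sink_component :: "('v,'e) pre_digraph \<Rightarrow> ('v,'e) pre_digraph \<Rightarrow> bool" where
  "sink_component D C \<longleftrightarrow> C \<in> pre_digraph.sccs D \<and>
     \<not> (\<exists>e\<in>arcs D. tail D e \<in> verts C \<and> head D e \<notin> verts C)"

definition sink_sided :: "('v,'e) pre_digraph \<Rightarrow> 'e set \<Rightarrow> bool" where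
  "sink_sided D B \<longleftrightarrow>
     \<not> (\<exists>C. sink_component D C \<and> verts C \<subseteq> out_shore D B) \<and>
     \<not> (\<exists>r. out_ray D r \<and> range r \<subseteq> out_shore D B)"

definition source_sided :: "('v,'e) pre_digraph \<Rightarrow> 'e set \<Rightarrow> bool" where
  "source_sided D B \<longleftrightarrow>
     \<not> (\<exists>C. source_component D C \<and> verts C \<subseteq> in_shore D B) \<and>
     \<not> (\<exists>r. back_ray D r \<and> range r \<subseteq> in_shore D B)"

definition source_sink_dicut :: "('v,'e) pre_digraph \<Rightarrow> 'e set \<Rightarrow> bool" where
  "source_sink_dicut D B \<longleftrightarrow> dicut D B \<and> (source_sided D B \<or> sink_sided D B)"

definition dijoin :: "('v,'e) pre_digraph \<Rightarrow> 'e set set \<Rightarrow> 'e set \<Rightarrow> bool" where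
  "dijoin D \<BB> F \<longleftrightarrow> F \<subseteq> arcs D \<and> (\<forall>B\<in>\<BB>. F \<inter> B \<noteq> {})"

definition disjoint_dijoins :: "('v,'e) pre_digraph \<Rightarrow> 'e set set \<Rightarrow> 'e set set \<Rightarrow> bool" where
  "disjoint_dijoins D \<BB> \<FF> \<longleftrightarrow> (\<forall>F\<in>\<FF>. dijoin D \<BB> F) \<and> pairwise disjnt \<FF>"

text \<open>\<open>\<FF>\<close> attains the maximum, \<open>B\<close> attains the minimum, and the two agree; sizes are compared as
  cardinals, so that the definition also makes sense for infinite dicuts.\<close>

definition woodall :: "('v,'e) pre_digraph \<Rightarrow> 'e set set \<Rightarrow> bool" where
  "woodall D \<BB> \<longleftrightarrow> (\<exists>B\<in>\<BB>. \<exists>\<FF>.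
     (\<forall>B'\<in>\<BB>. |B| \<le>o |B'| ) \<and>
     disjoint_dijoins D \<BB> \<FF> \<and> (\<forall>\<FF>'. disjoint_dijoins D \<BB> \<FF>' \<longrightarrow> |\<FF>'| \<le>o |\<FF>| ) \<and>
     |B| =o |\<FF>| )"

text \<open>Cardinals are represented as in the library, by well-orders \<open>r\<close> with
  \<open>Card_order r\<close>; their underlying type \<open>'k\<close> is arbitrary.\<close>

definition capacity :: "('v,'e) pre_digraph \<Rightarrow> ('e \<Rightarrow> 'k rel) \<Rightarrow> bool" where
  "capacity D c \<longleftrightarrow> (\<forall>e\<in>arcs D. Card_order (c e))"

definition cap :: "('e \<Rightarrow> 'k rel) \<Rightarrow> 'e set \<Rightarrow> ('e \<times> 'k) rel" where
  "cap c A = (CSUM e : |A|. c e)"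

definition finite_capacity :: "('e \<Rightarrow> 'k rel) \<Rightarrow> 'e set \<Rightarrow> bool" where
  "finite_capacity c A \<longleftrightarrow> finite (Field (cap c A))"

definition c_disjoint ::
  "('v,'e) pre_digraph \<Rightarrow> ('e \<Rightarrow> 'k rel) \<Rightarrow> 'i set \<Rightarrow> ('i \<Rightarrow> 'e set) \<Rightarrow> bool" where
  "c_disjoint D c I F \<longleftrightarrow> (\<forall>e\<in>arcs D. |{i\<in>I. e \<in> F i}| \<le>o c e)"

definition c_disjoint_dijoins ::
  "('v,'e) pre_digraph \<Rightarrow> 'e set set \<Rightarrow> ('e \<Rightarrow> 'k rel) \<Rightarrow> 'i set \<Rightarrow> ('i \<Rightarrow> 'e set) \<Rightarrow> bool" where
  "c_disjoint_dijoins D \<BB> c I F \<longleftrightarrow> (\<forall>i\<in>I. dijoin D \<BB> (F i)) \<and> c_disjoint D c I F"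

text \<open>A definition cannot quantify over the type of the index set \<open>I\<close>, so index sets are taken from
  the type \<open>'e \<times> 'k\<close>. By \<open>c_disjoint_dijoins_reindex\<close> below, every \<open>c\<close>-disjoint family
  of dijoins over an arbitrary index type has a reindexing of this form, so nothing is lost.\<close>

definition woodall_wrt :: "('v,'e) pre_digraph \<Rightarrow> 'e set set \<Rightarrow> ('e \<Rightarrow> 'k rel) \<Rightarrow> bool" where
  "woodall_wrt D \<BB> c \<longleftrightarrow> (\<exists>B\<in>\<BB>. \<exists>(I :: ('e \<times> 'k) set) F.
     (\<forall>B'\<in>\<BB>. cap c B \<le>o cap c B') \<and>
     c_disjoint_dijoins D \<BB> c I F \<and>
     (\<forall>(I' :: ('e \<times> 'k) set) F'. c_disjoint_dijoins D \<BB> c I' F' \<longrightarrow> |I'| \<le>o |I| ) \<and>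
     cap c B =o |I| )"

lemma c_disjoint_dijoins_reindex:
  fixes D :: "('v,'e) pre_digraph" and c :: "'e \<Rightarrow> 'k rel" and I :: "'i set"
  assumes c: "capacity D c" and "B \<in> \<BB>" and fam: "c_disjoint_dijoins D \<BB> c I F"
  shows "\<exists>(J :: ('e \<times> 'k) set) g. J \<subseteq> Field (cap c B) \<and> bij_betw g J I \<and>
    c_disjoint_dijoins D \<BB> c J (F \<circ> g)"
proof -
  have "\<forall>i\<in>I. \<exists>e. e \<in> F i \<inter> B \<and> e \<in> arcs D"
    using fam \<open>B \<in> \<BB>\<close> unfolding c_disjoint_dijoins_def dijoin_def by blast
  then obtain p where p: "\<And>i. i \<in> I \<Longrightarrow> p i \<in> F i \<inter> B \<and> p i \<in> arcs D"
    by metis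
  have "\<forall>e\<in>arcs D. \<exists>h. inj_on h {i\<in>I. e \<in> F i} \<and> h ` {i\<in>I. e \<in> F i} \<subseteq> Field (c e)"
  proof
    fix e assume e: "e \<in> arcs D"
    have "|{i\<in>I. e \<in> F i}| \<le>o c e"
      using fam e unfolding c_disjoint_dijoins_def c_disjoint_def by blast
    also have "c e =o |Field (c e)|"
      using c e unfolding capacity_def by (meson card_of_Field_ordIso ordIso_symmetric)
    finally show "\<exists>h. inj_on h {i\<in>I. e \<in> F i} \<and> h ` {i\<in>I. e \<in> F i} \<subseteq> Field (c e)"
      by (simp add: card_of_ordLeq)
  qed
  then obtain h where h: "\<And>e. e \<in> arcs D \<Longrightarrow>
      inj_on (h e) {i\<in>I. e \<in> F i} \<and> h e ` {i\<in>I. e \<in> F i} \<subseteq> Field (c e)"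
    by metis
  define f where "f i = (p i, h (p i) i)" for i
  have inj: "inj_on f I"
  proof (rule inj_onI)
    fix i j assume ij: "i \<in> I" "j \<in> I" "f i = f j"
    then have "p i = p j" "h (p i) i = h (p i) j" by (auto simp: f_def)
    then show "i = j" using h[of "p i"] p[of i] p[of j] ij by (auto dest: inj_onD)
  qed
  let ?J = "f ` I" and ?g = "inv_into I f"
  have bij: "bij_betw ?g ?J I"
    using inj by (simp add: bij_betw_inv_into inj_on_imp_bij_betw)
  have sub: "?J \<subseteq> Field (cap c B)"
    using p h by (fastforce simp: f_def cap_def Csum_def Field_card_of)
  have "c_disjoint_dijoins D \<BB> c ?J (F \<circ> ?g)"
    unfolding c_disjoint_dijoins_def c_disjoint_def
  proof (intro conjI ballI)
    fix j assume "j \<in> ?J"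
    then show "dijoin D \<BB> ((F \<circ> ?g) j)"
      using fam inj by (auto simp: c_disjoint_dijoins_def)
  next
    fix e assume e: "e \<in> arcs D"
    have "{j \<in> ?J. e \<in> (F \<circ> ?g) j} \<subseteq> f ` {i\<in>I. e \<in> F i}"
      using inj by auto
    then have "|{j \<in> ?J. e \<in> (F \<circ> ?g) j}| \<le>o |{i\<in>I. e \<in> F i}|"
      by (rule ordLeq_transitive[OF card_of_mono1 card_of_image])
    also have "|{i\<in>I. e \<in> F i}| \<le>o c e"
      using fam e unfolding c_disjoint_dijoins_def c_disjoint_def by blast
    finally show "|{j \<in> ?J. e \<in> (F \<circ> ?g) j}| \<le>o c e" .
  qed
  then show ?thesis using bij sub by blast
qed

end

theory Submission
  imports Defs "HOL-Analysis.Function_Topology"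
begin

text \<open>
  Let \<open>k\<close> be the least size of a finite source-sink dicut. Disjoint dijoins each need an arc of their
  own in a smallest dicut, so there are at most \<open>k\<close> of them. Conversely, the classes of a colouring of
  the arcs are dijoins as soon as every finite source-sink dicut contains all \<open>k\<close> colours, and the proof
  constructs such a colouring. A capacity is treated by colouring \<open>c e\<close> copies of each arc \<open>e\<close>;
  an arc of capacity \<open>0\<close> has no copy, but it still takes part in deciding which cuts are dicuts.

  A sink-sided dicut is represented by its out-shore \<open>X\<close>, a source-sided one by its in-shore \<open>Y\<close>.
  The out-shores form a family that is closed under unions and non-empty intersections, and so do the
  in-shores. Moreover \<open>X - Y\<close> is an out-shore and \<open>Y - X\<close> an in-shore again. This is what the
  conditions on components and rays give: a non-empty set without incoming arcs contains a source
  component or a back-ray (\<open>closed_contains_end\<close>), hence is not contained in an in-shore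
  \<open>Y\<close>. For arbitrary dicuts \<open>X - Y\<close> may be empty. By compactness finitely many dicuts can be treated
  at a time, and together with the dicuts of the same kind in the finite Boolean algebra of vertex sets
  that they generate they form a finite problem, \<open>finite_source_sink_colouring\<close>.

  If no arc has its head, and none its tail, in both an out-shore and an in-shore, the finite problem
  separates. The arcs with head outside all out-shores and tail outside all in-shores
  belong to both sides; they are coloured such that every shore sees at least as many colours as its
  remaining arcs cannot supply (\<open>supermodular_colouring\<close>). Every other arc matters on one side only, and
  on each side the colouring is completed as in the theorem of Edmonds on disjoint branchings
  (\<open>extend_root_sets\<close>).

  The general finite problem is reduced to this case by induction. Call a vertex a middle vertex if
  it lies in an out-shore and in an in-shore. If some dicut with exactly \<open>k\<close> arcs has a middle vertex
  in its shore, the problem is cut along this dicut into two smaller ones, whose colourings agree on the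
  \<open>k\<close> arcs after a permutation of the colours (\<open>tight_decomposition\<close>). Otherwise all shores with
  a middle vertex have an arc to spare. Then an arc between two middle vertices may be deleted, and an
  arc \<open>a\<close> entering the middle may be merged with an arc \<open>b\<close> leaving it whenever every in-shore that
  contains the tail of \<open>b\<close> contains the head of \<open>a\<close>. When no step of this kind is possible, the out-shores
  without tails of arcs in the middle and the in-shores without heads of arcs in the middle control all
  others (\<open>pure_shores_suffice\<close>), and for these the problem separates.
\<close>

section \<open>Supermodular colourings\<close>

text \<open>
  The union of two matchings is a bipartite graph: its components are paths and even cycles. Instead of
  walking along these, the induction removes an edge \<open>{a, b}\<close> of \<open>N\<close> and joins the two partners
  \<open>a'\<close>, \<open>b'\<close> in \<open>M\<close> by an edge; a colouring in which \<open>a'\<close> and \<open>b'\<close> differ extends to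
  \<open>a\<close> and \<open>b\<close>.
\<close>

lemma two_matchings_bicolouring:
  assumes "finite N" "finite M"
    and "\<forall>p\<in>M \<union> N. card p = 2" and "pairwise disjnt M" and "pairwise disjnt N"
  shows "\<exists>f :: 'a \<Rightarrow> bool. \<forall>p\<in>M \<union> N. inj_on f p"
  using assms
proof (induction N arbitrary: M rule: finite_induct)
  case empty
  define f where "f x = (\<exists>p\<in>M. x = (SOME y. y \<in> p))" for x :: 'a
  have "f a \<noteq> f b" if p: "p \<in> M" and ab: "a \<in> p" "b \<in> p" "a \<noteq> b" for p a b
  proof -
    have "p = {a, b}" using ab empty p by (auto simp: card_2_iff)
    moreover have "(SOME y. y \<in> p) \<in> p" using ab by (meson someI)
    moreover have "f x \<longleftrightarrow> x = (SOME y. y \<in> p)" if "x \<in> p" for x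
    proof
      assume "f x"
      then obtain p' where p': "p' \<in> M" "x = (SOME y. y \<in> p')" by (auto simp: f_def)
      moreover have "p' \<noteq> {}" using empty(2) p'(1) by force
      ultimately have "x \<in> p'" by (simp add: some_in_eq)
      then have "p' = p" using that p p'(1) empty(3) by (auto simp: pairwise_def disjnt_def)
      then show "x = (SOME y. y \<in> p)" using p' by simp
    qed (use p in \<open>auto simp: f_def\<close>)
    ultimately show ?thesis using ab by auto
  qed
  then have "\<forall>p\<in>M \<union> {}. inj_on f p" by (auto simp: inj_on_def)
  then show ?case by blast
next
  case (insert q N)
  obtain a b where q: "q = {a, b}" "a \<noteq> b"
    using insert.prems(2) by (auto simp: card_2_iff)
  have fresh: "a \<notin> p \<and> b \<notin> p" if "p \<in> N" for p
    using insert.prems(4) insert.hyps(2) that q by (auto simp: pairwise_def disjnt_def)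
  have pN: "pairwise disjnt N" using insert.prems(4) by (simp add: pairwise_insert)
  have uniq: "p = p'" if "p \<in> M" "p' \<in> M" "x \<in> p" "x \<in> p'" for p p' x
    using insert.prems(3) that by (auto simp: pairwise_def disjnt_def)
  have partner: "\<exists>y. p = {x, y} \<and> x \<noteq> y" if "p \<in> M" "x \<in> p" for p x
  proof -
    have "card p = 2" using insert.prems(2) that by blast
    then obtain y z where "p = {y, z}" "y \<noteq> z" by (auto simp: card_2_iff)
    then show ?thesis using that(2) by auto
  qed
  note IH = insert.IH
  show ?case
  proof (cases "a \<in> \<Union>M \<and> b \<in> \<Union>M")
    case False
    then obtain c d where cd: "q = {c, d}" "c \<noteq> d" "c \<notin> \<Union>M" using q by auto
    obtain f :: "'a \<Rightarrow> bool" where f: "\<forall>p\<in>M \<union> N. inj_on f p"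
      using IH[of M] insert.prems pN by auto
    have "c = a \<or> c = b" using cd(1) q(1) by blast
    then have "c \<notin> p" if "p \<in> M \<union> N" for p using fresh cd(3) that by blast
    then have 1: "c \<notin> p" if "p \<in> M \<union> N" for p using cd(3) that by blast
    define f' where "f' = f(c := \<not> f d)"
    have "f' x \<noteq> f' y" if p: "p \<in> M \<union> insert q N" and xy: "x \<in> p" "y \<in> p" "x \<noteq> y" for p x y
    proof (cases "p = q")
      case True
      then show ?thesis using xy cd(1,2) by (auto simp: f'_def)
    next
      case False
      then have pMN: "p \<in> M \<union> N" using p by blast
      then have "x \<noteq> c" "y \<noteq> c" using 1 xy by blast+
      moreover have "f x \<noteq> f y" using f pMN xy inj_onD[of f p x y] by blast
      ultimately show ?thesis by (simp add: f'_def)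
    qed
    then have "\<forall>p\<in>M \<union> insert q N. inj_on f' p" unfolding inj_on_def by blast
    then show ?thesis by blast
  next
    case True
    then obtain p1 p2 where p: "p1 \<in> M" "a \<in> p1" "p2 \<in> M" "b \<in> p2" by auto
    show ?thesis
    proof (cases "p1 = p2")
      case True
      then have p1: "p1 = q" using p q partner[OF p(1,2)] by auto
      then have M: "M = insert q (M - {q})" using p by auto
      have "\<exists>f :: 'a \<Rightarrow> bool. \<forall>p\<in>(M - {q}) \<union> N. inj_on f p"
        by (rule IH) (use insert.prems pN in \<open>auto simp: pairwise_def\<close>)
      then obtain f :: "'a \<Rightarrow> bool" where
        f: "\<forall>p\<in>(M - {q}) \<union> N. inj_on f p" by blast
      have "a \<notin> p \<and> b \<notin> p" if "p \<in> (M - {q}) \<union> N" for p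
        using fresh that uniq p p1 True by blast
      then have 1: "a \<notin> p \<and> b \<notin> p" if "p \<in> (M - {q}) \<union> N" for p using that by blast
      define f' where "f' = f(a := \<not> f b)"
      have "f' x \<noteq> f' y" if p: "p \<in> M \<union> insert q N" and xy: "x \<in> p" "y \<in> p" "x \<noteq> y" for p x y
      proof (cases "p = q")
        case True
        then show ?thesis using xy q by (auto simp: f'_def)
      next
        case False
        then have pMN: "p \<in> (M - {q}) \<union> N" using p by blast
        then have "x \<noteq> a" "y \<noteq> a" using 1 xy by blast+
        moreover have "f x \<noteq> f y" using f pMN xy inj_onD[of f p x y] by blast
      ultimately show ?thesis by (simp add: f'_def)
      qed
      then have "\<forall>p\<in>M \<union> insert q N. inj_on f' p" unfolding inj_on_def by blast
      then show ?thesis by blast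
    next
      case False
      obtain a' where p1: "p1 = {a, a'}" "a \<noteq> a'"
        using partner[OF p(1,2)] by blast
      obtain b' where p2: "p2 = {b, b'}" "b \<noteq> b'"
        using partner[OF p(3,4)] by blast
      have ne: "a' \<noteq> b'" "a' \<noteq> b" "b' \<noteq> a" using False p p1 p2 uniq by auto
      define M' where "M' = insert {a', b'} (M - {p1, p2})"
      have fresh': "a \<notin> r \<and> b \<notin> r" if r: "r \<in> M' \<union> N" for r
      proof -
        consider "r \<in> N" | "r = {a', b'}" | "r \<in> M" "r \<noteq> p1" "r \<noteq> p2"
          using r by (auto simp: M'_def)
        then show ?thesis
        proof cases
          case 1
          then show ?thesis by (rule fresh)
        next
          case 2
          then show ?thesis using p1(2) p2(2) ne by simp
        next
          case 3
          then show ?thesis using uniq p by blast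
        qed
      qed
      have a'b': "a' \<in> p1" "b' \<in> p2" using p1 p2 by simp_all
      have "a' \<notin> r \<and> b' \<notin> r" if "r \<in> M" "r \<noteq> p1" "r \<noteq> p2" for r
        using that uniq[of r p1 a'] uniq[of r p2 b'] p(1,3) a'b' by blast
      moreover have "pairwise disjnt (M - {p1, p2})"
        using insert.prems(3) by (rule pairwise_mono) blast+
      ultimately have "pairwise disjnt M'" unfolding M'_def
        by (auto simp: pairwise_insert disjnt_def)
      moreover have "\<forall>p\<in>M' \<union> N. card p = 2"
        using insert.prems(2) ne by (auto simp: M'_def)
      moreover have "finite M'" using insert.prems(1) by (simp add: M'_def)
      ultimately have "\<exists>f :: 'a \<Rightarrow> bool. \<forall>p\<in>M' \<union> N. inj_on f p"
        using pN by (intro IH)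
      then obtain f :: "'a \<Rightarrow> bool" where
        f: "\<forall>p\<in>M' \<union> N. inj_on f p" by blast
      define f' where "f' = f(a := \<not> f a', b := \<not> f b')"
      have "{a', b'} \<in> M' \<union> N" by (simp add: M'_def)
      then have fab: "f a' \<noteq> f b'" using f ne(1) inj_onD[of f "{a', b'}" a' b'] by blast
      have 1: "inj_on f' r" if "r \<in> M' \<union> N" for r
      proof (rule inj_onI, rule ccontr)
        fix x y assume r: "x \<in> r" "y \<in> r" and eq: "f' x = f' y" "x \<noteq> y"
        have "x \<noteq> a" "x \<noteq> b" "y \<noteq> a" "y \<noteq> b" using fresh'[OF that] r by blast+
        moreover have "f x \<noteq> f y" using f that r eq(2) inj_onD[of f r x y] by blast
        ultimately show False using eq(1) by (simp add: f'_def)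
      qed
      have vals: "f' a = (\<not> f a')" "f' b = (\<not> f b')" "f' a' = f a'" "f' b' = f b'"
        using p1(2) p2(2) q(2) ne by (auto simp: f'_def)
      have "inj_on f' r" if r: "r = p1 \<or> r = p2 \<or> r = q" for r
      proof (rule inj_onI, rule ccontr)
        fix x y assume xy: "x \<in> r" "y \<in> r" "f' x = f' y" "x \<noteq> y"
        from r consider "{x, y} = {a, a'}" | "{x, y} = {b, b'}" | "{x, y} = {a, b}"
          using xy(1,2,4) unfolding p1(1) p2(1) q(1) by blast
        then show False using vals fab xy(3) by cases (auto simp: doubleton_eq_iff)
      qed
      moreover have "M \<union> insert q N \<subseteq> (M' \<union> N) \<union> {p1, p2, q}" unfolding M'_def by blast
      ultimately have "\<forall>p\<in>M \<union> insert q N. inj_on f' p" using 1 by blast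
      then show ?thesis by blast
    qed
  qed
qed

text \<open>
  Families of this kind play the role of intersecting families; closure under the union of disjoint
  members is included because the families of shores have it.
\<close>

definition lattice_family :: "'v set set \<Rightarrow> bool" where
  "lattice_family F \<longleftrightarrow> finite F \<and> {} \<notin> F \<and>
     (\<forall>X\<in>F. \<forall>Y\<in>F. X \<union> Y \<in> F \<and> (X \<inter> Y \<noteq> {} \<longrightarrow> X \<inter> Y \<in> F))"

definition supermodular_on :: "'v set set \<Rightarrow> ('v set \<Rightarrow> int) \<Rightarrow> bool" where
  "supermodular_on F g \<longleftrightarrow>
     (\<forall>X\<in>F. \<forall>Y\<in>F. X \<inter> Y \<noteq> {} \<longrightarrow> g X + g Y \<le> g (X \<inter> Y) + g (X \<union> Y))"

abbreviation arcs_at :: "'a set \<Rightarrow> ('a \<Rightarrow> 'v) \<Rightarrow> 'v set \<Rightarrow> 'a set" where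
  "arcs_at A t X \<equiv> {e \<in> A. t e \<in> X}"

lemma lattice_familyD:
  assumes "lattice_family F"
  shows "finite F" "{} \<notin> F" "X \<in> F \<Longrightarrow> Y \<in> F \<Longrightarrow> X \<union> Y \<in> F"
    "X \<in> F \<Longrightarrow> Y \<in> F \<Longrightarrow> x \<in> X \<Longrightarrow> x \<in> Y \<Longrightarrow> X \<inter> Y \<in> F"
  using assms by (auto simp: lattice_family_def)

lemma Union_lattice:
  assumes "\<V> \<noteq> {}" "finite \<V>" "\<And>X Y. X \<in> \<V> \<Longrightarrow> Y \<in> \<V> \<Longrightarrow> X \<union> Y \<in> \<V>"
  shows "\<Union>\<V> \<in> \<V>"
proof -
  have "\<Union>\<W> \<in> \<V>" if "finite \<W>" "\<W> \<noteq> {}" "\<W> \<subseteq> \<V>" for \<W>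
    using that by (induction \<W> rule: finite_ne_induct) (auto simp: assms(3))
  then show ?thesis using assms by auto
qed

lemma Inter_lattice:
  assumes "\<V> \<noteq> {}" "finite \<V>" "\<And>X Y. X \<in> \<V> \<Longrightarrow> Y \<in> \<V> \<Longrightarrow> X \<inter> Y \<in> \<V>"
  shows "\<Inter>\<V> \<in> \<V>"
proof -
  have "\<Inter>\<W> \<in> \<V>" if "finite \<W>" "\<W> \<noteq> {}" "\<W> \<subseteq> \<V>" for \<W>
    using that by (induction \<W> rule: finite_ne_induct) (auto simp: assms(3))
  then show ?thesis using assms by auto
qed

lemma card_coverage_submodular:
  assumes "finite A"
  shows "card (c ` arcs_at A t (X \<inter> Y) - K) + card (c ` arcs_at A t (X \<union> Y) - K)
      \<le> card (c ` arcs_at A t X - K) + card (c ` arcs_at A t Y - K)"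
proof -
  let ?P = "c ` arcs_at A t X - K" and ?Q = "c ` arcs_at A t Y - K"
  have fin: "finite ?P" "finite ?Q" using assms by auto
  have "c ` arcs_at A t (X \<union> Y) - K = ?P \<union> ?Q" by auto
  moreover have "card (c ` arcs_at A t (X \<inter> Y) - K) \<le> card (?P \<inter> ?Q)"
    by (rule card_mono) (use fin in auto)
  ultimately show ?thesis using card_Un_Int[OF fin] by simp
qed

lemma minimal_members_disjoint:
  assumes "\<And>X Y x. X \<in> L \<Longrightarrow> Y \<in> L \<Longrightarrow> x \<in> X \<Longrightarrow> x \<in> Y \<Longrightarrow> X \<inter> Y \<in> L"
  shows "pairwise disjnt {X \<in> L. \<forall>Y\<in>L. Y \<subseteq> X \<longrightarrow> Y = X}"
proof (clarsimp simp: pairwise_def disjnt_def)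
  fix X Y assume XY: "X \<in> L" "\<forall>Z\<in>L. Z \<subseteq> X \<longrightarrow> Z = X" "Y \<in> L" "\<forall>Z\<in>L. Z \<subseteq> Y \<longrightarrow> Z = Y" "X \<noteq> Y"
  show "X \<inter> Y = {}"
  proof (rule ccontr)
    assume "X \<inter> Y \<noteq> {}"
    then have "X \<inter> Y \<in> L" using assms XY by blast
    then have "X \<inter> Y = X" "X \<inter> Y = Y" using XY(2,4) by (meson inf_le1 inf_le2)+
    then show False using XY(5) by simp
  qed
qed

text \<open>
  The minimal members of \<open>L\<close> are disjoint, so two arcs chosen for each of them yield a matching, and
  every member of \<open>L\<close> contains a minimal one.
\<close>

lemma critical_pairs:
  assumes A: "finite A" and lat: "lattice_family F"
    and closed: "\<And>X Y x. X \<in> L \<Longrightarrow> Y \<in> L \<Longrightarrow> x \<in> X \<Longrightarrow> x \<in> Y \<Longrightarrow> X \<inter> Y \<in> L"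
    and "L \<subseteq> F"
    and two: "\<And>X. X \<in> L \<Longrightarrow> \<exists>e\<in>arcs_at A t X. \<exists>e'\<in>arcs_at A t X. e \<noteq> e' \<and> P e \<and> P e'"
  shows "\<exists>M. finite M \<and> pairwise disjnt M \<and> (\<forall>p\<in>M. card p = 2 \<and> p \<subseteq> {e\<in>A. P e}) \<and>
    (\<forall>X\<in>L. \<exists>p\<in>M. p \<subseteq> arcs_at A t X)"
proof -
  define L0 where "L0 = {X \<in> L. \<forall>Y\<in>L. Y \<subseteq> X \<longrightarrow> Y = X}"
  have fin: "finite L" using \<open>L \<subseteq> F\<close> lattice_familyD(1)[OF lat] by (rule finite_subset)
  have disj: "pairwise disjnt L0" unfolding L0_def by (rule minimal_members_disjoint) (rule closed)
  have "\<exists>p. card p = 2 \<and> p \<subseteq> arcs_at A t X \<and> p \<subseteq> {e\<in>A. P e}" if X: "X \<in> L" for X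
  proof -
    obtain e e' where "e\<in>arcs_at A t X" "e'\<in>arcs_at A t X" "e \<noteq> e'" "P e" "P e'"
      using two[OF X] by blast
    then show ?thesis by (intro exI[of _ "{e, e'}"]) auto
  qed
  then obtain p where p: "\<And>X. X \<in> L \<Longrightarrow> card (p X) = 2 \<and> p X \<subseteq> arcs_at A t X \<and> p X \<subseteq> {e\<in>A. P e}"
    by metis
  have "pairwise disjnt (p ` L0)"
  proof (clarsimp simp: pairwise_def)
    fix X Y assume XY: "X \<in> L0" "Y \<in> L0" "p X \<noteq> p Y"
    then have "X \<noteq> Y" by blast
    then have "X \<inter> Y = {}" using disj XY by (auto simp: pairwise_def disjnt_def)
    moreover have "p X \<subseteq> arcs_at A t X" "p Y \<subseteq> arcs_at A t Y" using p XY by (auto simp: L0_def)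
    ultimately show "disjnt (p X) (p Y)" by (auto simp: disjnt_def)
  qed
  moreover have "\<exists>q\<in>p ` L0. q \<subseteq> arcs_at A t X" if X: "X \<in> L" for X
  proof -
    obtain Z where Z: "Z \<in> L" "Z \<subseteq> X" "\<forall>Y\<in>L. Y \<subseteq> Z \<longrightarrow> Y = Z"
      using finite_has_minimal2[OF fin X] by metis
    then have "Z \<in> L0" by (simp add: L0_def)
    moreover have "p Z \<subseteq> arcs_at A t X" using p[OF Z(1)] Z(2) by auto
    ultimately show ?thesis by blast
  qed
  moreover have "finite (p ` L0)" using fin by (simp add: L0_def)
  ultimately show ?thesis using p by (intro exI[of _ "p ` L0"]) (auto simp: L0_def)
qed

text \<open>
  A Kempe exchange. The arcs of the colours \<open>i\<close> and \<open>j\<close> are divided anew between these two colours. A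
  shore is at risk only if it needs both colours; by supermodularity of the requirement, against
  submodularity of the number of other colours seen, the critical shores are closed under intersections,
  so it suffices to separate one pair of arcs in each minimal critical shore on either side. Besides
  preserving what is already satisfied, the exchange may satisfy shores whose requirement exceeds the
  number of colours they see, provided that the colours \<open>i\<close> and \<open>j\<close> together can supply it.
\<close>

lemma two_colour_exchange:
  fixes A :: "'a set" and t h :: "'a \<Rightarrow> 'v" and col :: "'a \<Rightarrow> nat"
  assumes A: "finite A" and lat1: "lattice_family F1" and lat2: "lattice_family F2"
    and sup1: "supermodular_on F1 g1" and sup2: "supermodular_on F2 g2" and ij: "i \<noteq> j"
    and need1: "\<And>X. X \<in> F1 \<Longrightarrow> g1 X \<le> int (card (col ` arcs_at A t X)) \<or>
      g1 X = 2 + int (card (col ` arcs_at A t X - {i, j})) \<and>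
      (\<exists>e\<in>arcs_at A t X. \<exists>e'\<in>arcs_at A t X. e \<noteq> e' \<and> col e \<in> {i, j} \<and> col e' \<in> {i, j})"
    and need2: "\<And>X. X \<in> F2 \<Longrightarrow> g2 X \<le> int (card (col ` arcs_at A h X)) \<or>
      g2 X = 2 + int (card (col ` arcs_at A h X - {i, j})) \<and>
      (\<exists>e\<in>arcs_at A h X. \<exists>e'\<in>arcs_at A h X. e \<noteq> e' \<and> col e \<in> {i, j} \<and> col e' \<in> {i, j})"
  shows "\<exists>col'. (\<forall>e. col' e \<in> {i, j, col e}) \<and>
    (\<forall>X\<in>F1. g1 X \<le> int (card (col' ` arcs_at A t X))) \<and> (\<forall>X\<in>F2. g2 X \<le> int (card (col' ` arcs_at A h X)))"
proof -
  define crit where "crit F g s = {X \<in> F. g X = 2 + int (card (col ` arcs_at A s X - {i, j}))}"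
    for F and g :: "'v set \<Rightarrow> int" and s :: "'a \<Rightarrow> 'v"
  define ok where "ok F g s \<longleftrightarrow> (\<forall>X\<in>F. g X \<le> int (card (col ` arcs_at A s X)) \<or>
      g X = 2 + int (card (col ` arcs_at A s X - {i, j})) \<and>
      (\<exists>e\<in>arcs_at A s X. \<exists>e'\<in>arcs_at A s X. e \<noteq> e' \<and> col e \<in> {i, j} \<and> col e' \<in> {i, j}))"
    for F and g :: "'v set \<Rightarrow> int" and s :: "'a \<Rightarrow> 'v"
  have oks: "ok F1 g1 t" "ok F2 g2 h" using need1 need2 by (auto simp: ok_def)
  have card_split: "card (c ` U) = card (c ` U - {i, j}) + card (c ` U \<inter> {i, j})"
    if "finite U" for c :: "'a \<Rightarrow> nat" and U
    using that by (metis card_Diff_subset_Int card_mono finite_imageI finite_Int inf_le1 le_add_diff_inverse2)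
  have le2: "card (S \<inter> {i, j}) \<le> 2" for S
    using card_mono[of "{i, j}" "S \<inter> {i, j}"] ij by simp
  have bound: "g X \<le> 2 + int (card (col ` arcs_at A s X - {i, j}))" if "ok F g s" "X \<in> F" for F g s X
  proof -
    have "finite (arcs_at A s X)" using A by simp
    from card_split[OF this, of col] le2[of "col ` arcs_at A s X"] that
    show ?thesis unfolding ok_def by fastforce
  qed
  have two: "\<exists>e\<in>arcs_at A s X. \<exists>e'\<in>arcs_at A s X. e \<noteq> e' \<and> col e \<in> {i, j} \<and> col e' \<in> {i, j}"
    if "ok F g s" "X \<in> crit F g s" for F g s X
  proof (cases "g X \<le> int (card (col ` arcs_at A s X))")
    case True
    have "finite (arcs_at A s X)" using A by simp
    from card_split[OF this, of col] True that(2)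
    have "card (col ` arcs_at A s X \<inter> {i, j}) \<ge> 2" by (auto simp: crit_def)
    then have "col ` arcs_at A s X \<inter> {i, j} = {i, j}" using ij
      by (intro card_seteq) auto
    then have "i \<in> col ` arcs_at A s X" "j \<in> col ` arcs_at A s X" by blast+
    then obtain e e' where e: "e \<in> arcs_at A s X" "col e = i" and e': "e' \<in> arcs_at A s X" "col e' = j"
      by blast
    then have "e \<noteq> e'" using ij by blast
    then show ?thesis using e e' by (intro bexI[of _ e] bexI[of _ e']) auto
  next
    case False
    then show ?thesis using that by (auto simp: ok_def crit_def)
  qed
  have closed: "X \<inter> Y \<in> crit F g s"
    if "ok F g s" "lattice_family F" "supermodular_on F g"
      "X \<in> crit F g s" "Y \<in> crit F g s" "x \<in> X" "x \<in> Y" for F g s X Y x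
  proof -
    have XY: "X \<in> F" "Y \<in> F" using that by (auto simp: crit_def)
    have mem: "X \<union> Y \<in> F" "X \<inter> Y \<in> F" using lattice_familyD(3,4)[OF that(2)] XY that by blast+
    have "g X + g Y \<le> g (X \<inter> Y) + g (X \<union> Y)"
      using that XY by (auto simp: supermodular_on_def)
    moreover have "g X = 2 + int (card (col ` arcs_at A s X - {i, j}))"
      "g Y = 2 + int (card (col ` arcs_at A s Y - {i, j}))" using that by (auto simp: crit_def)
    ultimately show ?thesis
      using card_coverage_submodular[OF A, where c=col and t=s and X=X and Y=Y and K="{i, j}"]
        bound[OF that(1) mem(1)] bound[OF that(1) mem(2)] mem
      unfolding crit_def mem_Collect_eq by linarith
  qed
  have "\<exists>M. finite M \<and> pairwise disjnt M \<and> (\<forall>p\<in>M. card p = 2 \<and> p \<subseteq> {e\<in>A. col e \<in> {i, j}}) \<and>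
      (\<forall>X\<in>crit F g s. \<exists>p\<in>M. p \<subseteq> arcs_at A s X)"
    if F: "ok F g s" "lattice_family F" "supermodular_on F g" for F g s
  proof (rule critical_pairs[OF A F(2)])
    show "X \<inter> Y \<in> crit F g s" if "X \<in> crit F g s" "Y \<in> crit F g s" "x \<in> X" "x \<in> Y" for X Y x
      by (rule closed[OF F that])
    show "crit F g s \<subseteq> F" by (auto simp: crit_def)
  qed (rule two[OF F(1)])
  note pairs = this
  obtain M1 where M1: "finite M1" "pairwise disjnt M1" "\<forall>p\<in>M1. card p = 2 \<and> p \<subseteq> {e\<in>A. col e \<in> {i, j}}"
      "\<forall>X\<in>crit F1 g1 t. \<exists>p\<in>M1. p \<subseteq> arcs_at A t X"
    using pairs[OF oks(1) lat1 sup1] by (elim exE conjE)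
  obtain M2 where M2: "finite M2" "pairwise disjnt M2" "\<forall>p\<in>M2. card p = 2 \<and> p \<subseteq> {e\<in>A. col e \<in> {i, j}}"
      "\<forall>X\<in>crit F2 g2 h. \<exists>p\<in>M2. p \<subseteq> arcs_at A h X"
    using pairs[OF oks(2) lat2 sup2] by (elim exE conjE)
  have M: "\<forall>p\<in>M1 \<union> M2. card p = 2" using M1(3) M2(3) by blast
  obtain f :: "'a \<Rightarrow> bool" where f: "\<forall>p\<in>M1 \<union> M2. inj_on f p"
    using two_matchings_bicolouring[OF M2(1) M1(1) M M1(2) M2(2)] by blast
  define col' where "col' e = (if col e \<in> {i, j} then if f e then i else j else col e)" for e
  have rest: "col' ` U - {i, j} = col ` U - {i, j}" for U
    by (auto simp: col'_def image_iff)
  have hit: "col' ` U \<inter> {i, j} \<noteq> {}" if "col ` U \<inter> {i, j} \<noteq> {}" for U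
    using that by (fastforce simp: col'_def)
  have good: "g X \<le> int (card (col' ` arcs_at A s X))"
    if ok: "ok F g s" and X: "X \<in> F" and crit: "X \<in> crit F g s \<Longrightarrow> \<exists>p\<in>M1 \<union> M2. p \<subseteq> arcs_at A s X" for F g s X
  proof -
    let ?U = "arcs_at A s X"
    have fin: "finite ?U" using A by simp
    have split': "card (col' ` ?U) = card (col ` ?U - {i, j}) + card (col' ` ?U \<inter> {i, j})"
      using card_split[OF fin, of col'] by (simp only: rest)
    show ?thesis
    proof (cases "X \<in> crit F g s")
      case True
      obtain p where p: "p \<in> M1 \<union> M2" "p \<subseteq> ?U" using crit[OF True] by blast
      have p2: "card p = 2" "p \<subseteq> {e\<in>A. col e \<in> {i, j}}"
        using p(1) M1(3) M2(3) by blast+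
      then obtain a b where ab: "p = {a, b}" "a \<noteq> b" by (auto simp: card_2_iff)
      then have "f a \<noteq> f b" using f p(1) inj_onD[of f p a b] by blast
      then have "col' ` p = {i, j}" using ab p2(2) by (auto simp: col'_def)
      then have "{i, j} \<subseteq> col' ` ?U" using image_mono[OF p(2), of col'] by simp
      then have "col' ` ?U \<inter> {i, j} = {i, j}" by blast
      then have "card (col' ` ?U \<inter> {i, j}) = 2" using ij by simp
      moreover have "g X = 2 + int (card (col ` ?U - {i, j}))" using True by (simp add: crit_def)
      ultimately show ?thesis using split' by linarith
    next
      case False
      then have le: "g X \<le> int (card (col ` ?U))" using ok X unfolding ok_def crit_def by blast
      have lt: "g X \<le> 1 + int (card (col ` ?U - {i, j}))"
        using bound[OF ok X] False X by (auto simp: crit_def)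
      show ?thesis
      proof (cases "col ` ?U \<inter> {i, j} = {}")
        case True
        then have "card (col ` ?U \<inter> {i, j}) = 0" by (simp only: card.empty)
        then show ?thesis using le card_split[OF fin, of col] split' by linarith
      next
        case False
        have "card (col' ` ?U \<inter> {i, j}) \<noteq> 0" using hit[OF False] fin by (simp only: card_eq_0_iff) simp
        then show ?thesis using lt split' by linarith
      qed
    qed
  qed
  have "g1 X \<le> int (card (col' ` arcs_at A t X))" if "X \<in> F1" for X
    by (rule good[OF oks(1) that]) (use M1(4) in blast)
  moreover have "g2 X \<le> int (card (col' ` arcs_at A h X))" if "X \<in> F2" for X
    by (rule good[OF oks(2) that]) (use M2(4) in blast)
  moreover have "\<forall>e. col' e \<in> {i, j, col e}" by (simp add: col'_def)
  ultimately show ?thesis by blast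
qed

text \<open>
  If all requirements hold up to one unit at shores through \<open>q\<close>, the violated shores pairwise meet in
  \<open>q\<close> and hence form a lattice, because the deficiency is supermodular and maximal on them. A single
  exchange repairs all of them: \<open>i\<close> is a colour missing in the largest violated shore and \<open>j\<close> a colour
  repeated in the smallest.
\<close>

lemma raise_requirement_at_vertex:
  fixes A :: "'a set" and t h :: "'a \<Rightarrow> 'v" and col :: "'a \<Rightarrow> nat"
  assumes A: "finite A" and lat1: "lattice_family F1" and lat2: "lattice_family F2"
    and sup1: "supermodular_on F1 g1" and sup2: "supermodular_on F2 g2"
    and bd: "\<And>X. X \<in> F1 \<Longrightarrow> g1 X \<le> int k \<and> g1 X \<le> int (card (arcs_at A t X))"
    and col: "col ` A \<subseteq> {..<k}"
    and col1: "\<And>X. X \<in> F1 \<Longrightarrow> g1 X - of_bool (q \<in> X) \<le> int (card (col ` arcs_at A t X))"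
    and col2: "\<And>X. X \<in> F2 \<Longrightarrow> g2 X \<le> int (card (col ` arcs_at A h X))"
  shows "\<exists>col'. col' ` A \<subseteq> {..<k} \<and>
    (\<forall>X\<in>F1. g1 X \<le> int (card (col' ` arcs_at A t X))) \<and>
    (\<forall>X\<in>F2. g2 X \<le> int (card (col' ` arcs_at A h X)))"
proof -
  define V where "V = {X \<in> F1. g1 X > int (card (col ` arcs_at A t X))}"
  show ?thesis
  proof (cases "V = {}")
    case True
    then show ?thesis using col col2 by (intro exI[of _ col]) (auto simp: V_def not_less)
  next
    case False
    have Vq: "q \<in> X" "g1 X = int (card (col ` arcs_at A t X)) + 1" "X \<in> F1" if "X \<in> V" for X
      using that col1[of X] by (cases "q \<in> X"; simp add: V_def)+
    have finV: "finite V" using lattice_familyD(1)[OF lat1] by (simp add: V_def)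
    have V2: "X \<inter> Y \<in> V \<and> X \<union> Y \<in> V" if XY: "X \<in> V" "Y \<in> V" for X Y
    proof -
      have mem: "X \<union> Y \<in> F1" "X \<inter> Y \<in> F1"
        using lattice_familyD(3,4)[OF lat1] Vq[OF XY(1)] Vq[OF XY(2)] by blast+
      have "g1 X + g1 Y \<le> g1 (X \<inter> Y) + g1 (X \<union> Y)"
        using sup1 Vq[OF XY(1)] Vq[OF XY(2)] unfolding supermodular_on_def by blast
      moreover have "q \<in> X \<inter> Y" "q \<in> X \<union> Y" using Vq(1) XY by blast+
      ultimately show ?thesis
        using card_coverage_submodular[OF A, where c=col and t=t and X=X and Y=Y and K="{}"]
          col1[OF mem(1)] col1[OF mem(2)] mem Vq(2)[OF XY(1)] Vq(2)[OF XY(2)]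
        by (simp add: V_def)
    qed
    have top: "\<Union>V \<in> V" by (rule Union_lattice[OF False finV]) (use V2 in blast)
    have bot: "\<Inter>V \<in> V" by (rule Inter_lattice[OF False finV]) (use V2 in blast)
    have "int (card (col ` arcs_at A t (\<Union>V))) < int k"
      using Vq(2)[OF top] bd[OF Vq(3)[OF top]] by linarith
    then have "\<not> {..<k} \<subseteq> col ` arcs_at A t (\<Union>V)"
      using card_mono[of "col ` arcs_at A t (\<Union>V)" "{..<k}"] A by auto
    then obtain i where i: "i < k" "i \<notin> col ` arcs_at A t (\<Union>V)" by auto
    have "card (col ` arcs_at A t (\<Inter>V)) < card (arcs_at A t (\<Inter>V))"
      using Vq(2)[OF bot] bd[OF Vq(3)[OF bot]] by linarith
    then have "\<not> inj_on col (arcs_at A t (\<Inter>V))" using card_image by fastforce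
    then obtain e e' where e: "e \<in> arcs_at A t (\<Inter>V)" "e' \<in> arcs_at A t (\<Inter>V)" "e \<noteq> e'" "col e = col e'"
      by (auto simp: inj_on_def)
    define j where "j = col e"
    have in_V: "e \<in> arcs_at A t X" "e' \<in> arcs_at A t X" "i \<notin> col ` arcs_at A t X" if "X \<in> V" for X
      using e i that by auto
    have "i \<noteq> j" using in_V[OF top] by (auto simp: j_def)
    have crit: "g1 X = 2 + int (card (col ` arcs_at A t X - {i, j}))" if "X \<in> V" for X
    proof -
      have eq: "col ` arcs_at A t X - {i, j} = col ` arcs_at A t X - {j}" using in_V(3)[OF that] by blast
      have "j \<in> col ` arcs_at A t X" using in_V(1)[OF that] by (auto simp: j_def)
      moreover have "finite (col ` arcs_at A t X)" using A by simp
      ultimately have "card (col ` arcs_at A t X) = Suc (card (col ` arcs_at A t X - {i, j}))"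
        unfolding eq by (intro card_Suc_Diff1[symmetric])
      then show ?thesis using Vq(2)[OF that] by simp
    qed
    have "\<exists>col'. (\<forall>e. col' e \<in> {i, j, col e}) \<and>
      (\<forall>X\<in>F1. g1 X \<le> int (card (col' ` arcs_at A t X))) \<and>
      (\<forall>X\<in>F2. g2 X \<le> int (card (col' ` arcs_at A h X)))"
    proof (rule two_colour_exchange[OF A lat1 lat2 sup1 sup2 \<open>i \<noteq> j\<close>])
      fix X assume X: "X \<in> F1"
      show "g1 X \<le> int (card (col ` arcs_at A t X)) \<or> g1 X = 2 + int (card (col ` arcs_at A t X - {i, j})) \<and>
        (\<exists>e\<in>arcs_at A t X. \<exists>e'\<in>arcs_at A t X. e \<noteq> e' \<and> col e \<in> {i, j} \<and> col e' \<in> {i, j})"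
      proof (cases "X \<in> V")
        case True
        have "col e \<in> {i, j}" "col e' \<in> {i, j}" using e(4) by (auto simp: j_def)
        then show ?thesis using crit[OF True] in_V(1,2)[OF True] e(3) by blast
      qed (use X in \<open>simp add: V_def not_less\<close>)
    next
      fix X assume "X \<in> F2"
      then show "g2 X \<le> int (card (col ` arcs_at A h X)) \<or> g2 X = 2 + int (card (col ` arcs_at A h X - {i, j})) \<and>
        (\<exists>e\<in>arcs_at A h X. \<exists>e'\<in>arcs_at A h X. e \<noteq> e' \<and> col e \<in> {i, j} \<and> col e' \<in> {i, j})"
        using col2 by blast
    qed
    then obtain col' where col': "\<forall>e. col' e \<in> {i, j, col e}"
      "\<forall>X\<in>F1. g1 X \<le> int (card (col' ` arcs_at A t X))"
      "\<forall>X\<in>F2. g2 X \<le> int (card (col' ` arcs_at A h X))" by (elim exE conjE)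
    have "j < k" using e(1) col by (auto simp: j_def)
    have "col' ` A \<subseteq> {..<k}"
    proof clarsimp
      fix x assume "x \<in> A"
      then have "col x < k" using col by auto
      then show "col' x < k" using col'(1) \<open>i < k\<close> \<open>j < k\<close> by (metis insertE singletonD)
    qed
    then show ?thesis using col' by blast
  qed
qed

text \<open>
  The list \<open>qs\<close> stands for a modular function: the requirement of \<open>X\<close> is first lowered by the number of
  entries in \<open>X\<close>, which keeps it supermodular, and then raised again one entry at a time.
\<close>

lemma raise_requirement_modular:
  fixes A :: "'a set" and t h :: "'a \<Rightarrow> 'v" and n :: "'v \<Rightarrow> nat"
  assumes A: "finite A" and lat1: "lattice_family F1" and lat2: "lattice_family F2"
    and sup1: "supermodular_on F1 g1" and sup2: "supermodular_on F2 g2"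
    and bd: "\<And>X. X \<in> F1 \<Longrightarrow> g1 X \<le> int k \<and> g1 X \<le> int (card (arcs_at A t X))"
    and ex: "\<exists>col :: 'a \<Rightarrow> nat. col ` A \<subseteq> {..<k} \<and>
      (\<forall>X\<in>F1. g1 X - int (length (filter (\<lambda>q. q \<in> X) qs)) \<le> int (card (col ` arcs_at A t X))) \<and>
      (\<forall>X\<in>F2. g2 X \<le> int (card (col ` arcs_at A h X)))"
  shows "\<exists>col :: 'a \<Rightarrow> nat. col ` A \<subseteq> {..<k} \<and>
    (\<forall>X\<in>F1. g1 X \<le> int (card (col ` arcs_at A t X))) \<and>
    (\<forall>X\<in>F2. g2 X \<le> int (card (col ` arcs_at A h X)))"
  using ex
proof (induction qs)
  case Nil
  then show ?case by simp
next
  case (Cons q qs)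
  let ?g = "\<lambda>X. g1 X - int (length (filter (\<lambda>q. q \<in> X) qs))"
  obtain col :: "'a \<Rightarrow> nat" where col: "col ` A \<subseteq> {..<k}"
    "\<forall>X\<in>F1. g1 X - int (length (filter (\<lambda>q. q \<in> X) (q # qs))) \<le> int (card (col ` arcs_at A t X))"
    "\<forall>X\<in>F2. g2 X \<le> int (card (col ` arcs_at A h X))" using Cons.prems by (elim exE conjE)
  have modular: "length (filter (\<lambda>q. q \<in> X) qs) + length (filter (\<lambda>q. q \<in> Y) qs)
      = length (filter (\<lambda>q. q \<in> X \<inter> Y) qs) + length (filter (\<lambda>q. q \<in> X \<union> Y) qs)" for X Y
    by (induction qs) auto
  have "supermodular_on F1 ?g"
    unfolding supermodular_on_def
  proof (intro ballI impI)
    fix X Y assume "X \<in> F1" "Y \<in> F1" "X \<inter> Y \<noteq> {}"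
    then have "g1 X + g1 Y \<le> g1 (X \<inter> Y) + g1 (X \<union> Y)" using sup1 by (simp add: supermodular_on_def)
    then show "?g X + ?g Y \<le> ?g (X \<inter> Y) + ?g (X \<union> Y)" using modular[of X Y] by linarith
  qed
  then have "\<exists>col'. col' ` A \<subseteq> {..<k} \<and>
    (\<forall>X\<in>F1. ?g X \<le> int (card (col' ` arcs_at A t X))) \<and>
    (\<forall>X\<in>F2. g2 X \<le> int (card (col' ` arcs_at A h X)))"
  proof (rule raise_requirement_at_vertex[OF A lat1 lat2 _ sup2, where col=col and q=q])
    fix X assume X: "X \<in> F1"
    show "?g X \<le> int k \<and> ?g X \<le> int (card (arcs_at A t X))" using bd[OF X] by auto
    show "?g X - of_bool (q \<in> X) \<le> int (card (col ` arcs_at A t X))"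
      using bspec[OF col(2) X] by (cases "q \<in> X") simp_all
  qed (use col in auto)
  then show ?case by (rule Cons.IH)
qed

text \<open>
  Schrijver's theorem on supermodular colourings, for two families given by the tails and by the heads
  of the arcs. Lowering the requirements by a large modular function makes them trivial, and
  \<open>raise_requirement_modular\<close> restores them on one side and then on the other.
\<close>

lemma supermodular_colouring:
  fixes A :: "'a set" and t h :: "'a \<Rightarrow> 'v"
  assumes A: "finite A" and lat1: "lattice_family F1" and lat2: "lattice_family F2"
    and sup1: "supermodular_on F1 g1" and sup2: "supermodular_on F2 g2"
    and bd1: "\<And>X. X \<in> F1 \<Longrightarrow> g1 X \<le> int k \<and> g1 X \<le> int (card (arcs_at A t X))"
    and bd2: "\<And>X. X \<in> F2 \<Longrightarrow> g2 X \<le> int k \<and> g2 X \<le> int (card (arcs_at A h X))"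
    and k: "k > 0"
  shows "\<exists>col :: 'a \<Rightarrow> nat. col ` A \<subseteq> {..<k} \<and>
    (\<forall>X\<in>F1. g1 X \<le> int (card (col ` arcs_at A t X))) \<and>
    (\<forall>X\<in>F2. g2 X \<le> int (card (col ` arcs_at A h X)))"
proof -
  have weights: "\<exists>qs. \<forall>X\<in>F. k \<le> length (filter (\<lambda>q. q \<in> X) qs)" if "lattice_family F" for F :: "'v set set"
  proof -
    obtain Fs where Fs: "set Fs = F" using lattice_familyD(1)[OF \<open>lattice_family F\<close>] finite_list by blast
    define qs where "qs = concat (map (\<lambda>X. replicate k (SOME q. q \<in> X)) Fs)"
    have "k \<le> length (filter (\<lambda>q. q \<in> X) qs)" if "X \<in> F" for X
    proof -
      have "X \<noteq> {}" using that lattice_familyD(2)[OF \<open>lattice_family F\<close>] by blast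
      then have "(SOME q. q \<in> X) \<in> X" by (simp add: some_in_eq)
      moreover have "X \<in> set Fs" using that Fs by simp
      then obtain xs ys where "Fs = xs @ X # ys" by (blast dest: split_list)
      ultimately show ?thesis by (simp add: qs_def)
    qed
    then show ?thesis by blast
  qed
  obtain ps where ps: "\<forall>X\<in>F1. k \<le> length (filter (\<lambda>q. q \<in> X) ps)" using weights[OF lat1] by blast
  obtain qs where qs: "\<forall>X\<in>F2. k \<le> length (filter (\<lambda>q. q \<in> X) qs)" using weights[OF lat2] by blast
  let ?g = "\<lambda>X. g1 X - int (length (filter (\<lambda>q. q \<in> X) ps))"
  have nonpos: "?g X \<le> 0" if "X \<in> F1" for X using bspec[OF ps that] bd1[OF that] by linarith
  have nonpos2: "g2 X - int (length (filter (\<lambda>q. q \<in> X) qs)) \<le> 0" if "X \<in> F2" for X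
    using bspec[OF qs that] bd2[OF that] by linarith
  have "supermodular_on F1 (\<lambda>_. 0)" by (simp add: supermodular_on_def)
  then have "\<exists>col :: 'a \<Rightarrow> nat. col ` A \<subseteq> {..<k} \<and>
    (\<forall>X\<in>F2. g2 X \<le> int (card (col ` arcs_at A h X))) \<and>
    (\<forall>X\<in>F1. 0 \<le> int (card (col ` arcs_at A t X)))"
  proof (rule raise_requirement_modular[OF A lat2 lat1 sup2 _ bd2])
    show "\<exists>col :: 'a \<Rightarrow> nat. col ` A \<subseteq> {..<k} \<and>
      (\<forall>X\<in>F2. g2 X - int (length (filter (\<lambda>q. q \<in> X) qs)) \<le> int (card (col ` arcs_at A h X))) \<and>
      (\<forall>X\<in>F1. 0 \<le> int (card (col ` arcs_at A t X)))"
      using k order_trans[OF nonpos2 of_nat_0_le_iff] by (intro exI[of _ "\<lambda>_. 0"]) auto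
  qed
  then obtain col0 :: "'a \<Rightarrow> nat" where col0: "col0 ` A \<subseteq> {..<k}"
    "\<forall>X\<in>F2. g2 X \<le> int (card (col0 ` arcs_at A h X))" by blast
  have "\<forall>X\<in>F1. ?g X \<le> int (card (col0 ` arcs_at A t X))" using order_trans[OF nonpos of_nat_0_le_iff] by blast
  then show ?thesis
    using col0 by (intro raise_requirement_modular[OF A lat1 lat2 sup1 sup2 bd1]) blast+
qed

section \<open>Disjoint branchings and bibranchings\<close>

text \<open>
  The roles of \<open>t\<close> and \<open>h\<close> are exchanged for in-shores: \<open>leaving E h t Y\<close> is the set of arcs
  that enter \<open>Y\<close>.
\<close>

definition leaving :: "'a set \<Rightarrow> ('a \<Rightarrow> 'v) \<Rightarrow> ('a \<Rightarrow> 'v) \<Rightarrow> 'v set \<Rightarrow> 'a set" where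
  "leaving E t h X = {e \<in> E. t e \<in> X \<and> h e \<notin> X}"

text \<open>
  The number of arcs leaving minus the number of arcs entering. It is linear in the indicator function of
  \<open>X\<close>, which makes every uncrossing identity below a comparison of indicator functions.
\<close>

definition net :: "'a set \<Rightarrow> ('a \<Rightarrow> 'v) \<Rightarrow> ('a \<Rightarrow> 'v) \<Rightarrow> 'v set \<Rightarrow> int" where
  "net E t h X = (\<Sum>e\<in>E. of_bool (t e \<in> X) - of_bool (h e \<in> X))"

lemma card_leaving_eq_net:
  assumes "finite E" and "\<And>e. e \<in> E \<Longrightarrow> h e \<in> X \<Longrightarrow> t e \<in> X"
  shows "int (card (leaving E t h X)) = net E t h X"
proof -
  have "net E t h X = (\<Sum>e\<in>E. of_bool (e \<in> leaving E t h X))"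
    unfolding net_def by (rule sum.cong) (use assms(2) in \<open>auto simp: leaving_def of_bool_def\<close>)
  also have "\<dots> = int (card (E \<inter> {e. e \<in> leaving E t h X}))"
    using assms(1) by (simp only: sum_of_bool_eq)
  also have "E \<inter> {e. e \<in> leaving E t h X} = leaving E t h X" by (auto simp: leaving_def)
  finally show ?thesis by simp
qed

lemma net_Un_Int: "net E t h X + net E t h Y = net E t h (X \<inter> Y) + net E t h (X \<union> Y)"
  unfolding net_def sum.distrib[symmetric] by (rule sum.cong) (auto simp: of_bool_def)

lemma net_swap: "net E h t X = - net E t h X"
  unfolding net_def sum_negf[symmetric] by (rule sum.cong) auto

lemma net_Diff: "net E t h X - net E t h Y = net E t h (X - Y) - net E t h (Y - X)"
  unfolding net_def sum_subtractf[symmetric] by (rule sum.cong) (auto simp: of_bool_def)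

lemma finite_leaving: "finite E \<Longrightarrow> finite (leaving E t h X)"
  by (simp add: leaving_def)

lemma card_indices_submodular:
  fixes R :: "nat \<Rightarrow> 'v set" and k :: nat
  defines "p \<equiv> \<lambda>X. card {i. i < k \<and> R i \<inter> X \<noteq> {}}"
  shows "p (X \<inter> Y) + p (X \<union> Y) \<le> p X + p Y"
    and "i < k \<Longrightarrow> R i \<inter> X \<noteq> {} \<Longrightarrow> R i \<inter> Y \<noteq> {} \<Longrightarrow> R i \<inter> (X \<inter> Y) = {} \<Longrightarrow>
      p (X \<inter> Y) + p (X \<union> Y) < p X + p Y"
proof -
  let ?I = "\<lambda>X. {i. i < k \<and> R i \<inter> X \<noteq> {}}"
  have un: "?I (X \<union> Y) = ?I X \<union> ?I Y" and int: "?I (X \<inter> Y) \<subseteq> ?I X \<inter> ?I Y" by auto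
  have sum: "card (?I X) + card (?I Y) = card (?I X \<inter> ?I Y) + card (?I (X \<union> Y))"
    unfolding un by (subst add.commute[of "card (_ \<inter> _)"]) (rule card_Un_Int; simp)
  have fin: "finite (?I X \<inter> ?I Y)" by simp
  show "p (X \<inter> Y) + p (X \<union> Y) \<le> p X + p Y"
    using card_mono[OF fin int] sum unfolding p_def by linarith
  assume "i < k" "R i \<inter> X \<noteq> {}" "R i \<inter> Y \<noteq> {}" "R i \<inter> (X \<inter> Y) = {}"
  then have "i \<in> ?I X \<inter> ?I Y" "i \<notin> ?I (X \<inter> Y)" by simp_all
  then have "?I (X \<inter> Y) \<subset> ?I X \<inter> ?I Y" using int by blast
  from psubset_card_mono[OF fin this] show "p (X \<inter> Y) + p (X \<union> Y) < p X + p Y"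
    using sum unfolding p_def by linarith
qed

text \<open>
  Edmonds' theorem on disjoint branchings with prescribed root sets, by the proof of Lovasz. \<open>R i\<close> is the
  set of vertices already reached in colour \<open>i\<close>; an arc of colour \<open>i\<close> is needed only in shores that miss
  \<open>R i\<close>. Arcs are coloured one at a time: an arc leaving the largest shore \<open>X0\<close> that misses \<open>R i\<close>
  gets colour \<open>i\<close> and its tail becomes reached. The condition survives unless the arc leaves a tight
  shore that meets \<open>R i\<close>. Submodularity of the number of colours plus the number of arcs shows that
  some arc leaving \<open>X0\<close> within a minimal such shore is safe.
\<close>

lemma extend_root_sets:
  fixes E :: "'a set" and t h :: "'a \<Rightarrow> 'v" and R :: "nat \<Rightarrow> 'v set"
  assumes "finite E" and lat: "lattice_family F"
    and "\<And>X e. X \<in> F \<Longrightarrow> e \<in> E \<Longrightarrow> h e \<in> X \<Longrightarrow> t e \<in> X"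
    and "\<And>X. X \<in> F \<Longrightarrow> k \<le> card {i. i < k \<and> R i \<inter> X \<noteq> {}} + card (leaving E t h X)"
  shows "\<exists>col :: 'a \<Rightarrow> nat. \<forall>X\<in>F. \<forall>i<k. R i \<inter> X = {} \<longrightarrow> (\<exists>e\<in>leaving E t h X. col e = i)"
  using assms(1,3,4)
proof (induction "card E" arbitrary: E R rule: less_induct)
  case less
  note fin = less.prems(1) and noenter = less.prems(2) and cond = less.prems(3)
  define p where "p X = card {i. i < k \<and> R i \<inter> X \<noteq> {}}" for X
  define d where "d X = card (leaving E t h X)" for X
  have cond': "k \<le> p X + d X" if "X \<in> F" for X using cond[OF that] by (simp add: p_def d_def)
  have d_mod: "d X + d Y = d (X \<inter> Y) + d (X \<union> Y)"
    if "X \<in> F" "Y \<in> F" for X Y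
  proof -
    have dn: "int (d Z) = net E t h Z" if "Z \<in> {X, Y, X \<inter> Y, X \<union> Y}" for Z
      unfolding d_def by (rule card_leaving_eq_net[OF fin])
        (use that noenter \<open>X \<in> F\<close> \<open>Y \<in> F\<close> in blast)
    show ?thesis using net_Un_Int[of E t h X Y] dn[of X] dn[of Y] dn[of "X \<inter> Y"] dn[of "X \<union> Y"]
      by simp
  qed
  show ?case
  proof (cases "\<forall>X\<in>F. \<forall>i<k. R i \<inter> X \<noteq> {}")
    case True
    then show ?thesis by blast
  next
    case False
    then obtain i X1 where i: "i < k" and X1: "X1 \<in> F" "R i \<inter> X1 = {}" by blast
    define G where "G = {X \<in> F. R i \<inter> X = {}}"
    define X0 where "X0 = \<Union>G"
    have "X0 \<in> G" unfolding X0_def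
    proof (rule Union_lattice)
      show "G \<noteq> {}" using X1 by (auto simp: G_def)
      show "finite G" using lattice_familyD(1)[OF lat] by (simp add: G_def)
    qed (use lattice_familyD(3)[OF lat] in \<open>auto simp: G_def\<close>)
    then have X0: "X0 \<in> F" "R i \<inter> X0 = {}" by (simp_all add: G_def)
    have X0_max: "X \<subseteq> X0" if "X \<in> F" "R i \<inter> X = {}" for X using that by (auto simp: X0_def G_def)
    have "p X0 \<le> card ({..<k} - {i})" unfolding p_def
      by (rule card_mono) (use X0(2) in auto)
    then have "p X0 < k" using i by simp
    then have "d X0 > 0" using cond'[OF X0(1)] by linarith
    then have "leaving E t h X0 \<noteq> {}" by (auto simp: d_def)
    define Bad where "Bad = {Z \<in> F. R i \<inter> Z \<noteq> {} \<and> p Z + d Z = k \<and> Z \<inter> X0 \<noteq> {}}"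
    have "\<exists>e\<in>leaving E t h X0. \<forall>Z\<in>F. R i \<inter> Z \<noteq> {} \<and> e \<in> leaving E t h Z \<longrightarrow> p Z + d Z > k"
    proof (cases "Bad = {}")
      case True
      obtain e where e: "e \<in> leaving E t h X0" using \<open>leaving E t h X0 \<noteq> {}\<close> by blast
      have "p Z + d Z > k" if Z: "Z \<in> F" "R i \<inter> Z \<noteq> {}" "e \<in> leaving E t h Z" for Z
      proof -
        have "Z \<inter> X0 \<noteq> {}" using e Z(3) by (auto simp: leaving_def)
        then have "p Z + d Z \<noteq> k" using True Z by (auto simp: Bad_def)
        then show ?thesis using cond'[OF Z(1)] by simp
      qed
      then show ?thesis using e by blast
    next
      case False
      have "finite Bad" using lattice_familyD(1)[OF lat] by (simp add: Bad_def)
      then obtain Z where Z: "Z \<in> Bad" "\<And>Z'. Z' \<in> Bad \<Longrightarrow> Z' \<subseteq> Z \<Longrightarrow> Z' = Z"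
        using finite_has_minimal[OF _ False] by metis
      then have ZF: "Z \<in> F" "R i \<inter> Z \<noteq> {}" "p Z + d Z = k" "Z \<inter> X0 \<noteq> {}" by (auto simp: Bad_def)
      have ZX: "Z \<inter> X0 \<in> F" using lattice_familyD(4)[OF lat ZF(1) X0(1)] ZF(4) by blast
      have "p (Z \<inter> X0) < p Z" unfolding p_def
        by (rule psubset_card_mono) (use i ZF(2) X0(2) in auto)
      then have "d Z < d (Z \<inter> X0)" using cond'[OF ZX] ZF(3) by linarith
      then have "\<not> leaving E t h (Z \<inter> X0) \<subseteq> leaving E t h Z"
        using card_mono[OF finite_leaving[OF fin]] unfolding d_def by (metis not_le)
      then obtain e where e: "e \<in> E" "t e \<in> Z" "t e \<in> X0" "h e \<in> Z" "h e \<notin> X0"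
        by (auto simp: leaving_def)
      have "p Z' + d Z' > k" if Z': "Z' \<in> F" "R i \<inter> Z' \<noteq> {}" "e \<in> leaving E t h Z'" for Z'
      proof (rule ccontr)
        assume "\<not> p Z' + d Z' > k"
        then have tight: "p Z' + d Z' = k" using cond'[OF Z'(1)] by simp
        have te: "t e \<in> Z'" "h e \<notin> Z'" using Z'(3) by (auto simp: leaving_def)
        have ZZ: "Z \<inter> Z' \<in> F" "Z \<union> Z' \<in> F"
          using lattice_familyD(3,4)[OF lat ZF(1) Z'(1)] e(2) te(1) by blast+
        have sum: "p Z + p Z' \<le> p (Z \<inter> Z') + p (Z \<union> Z')"
          using d_mod[OF ZF(1) Z'(1)] cond'[OF ZZ(1)] cond'[OF ZZ(2)] ZF(3) tight by linarith
        then have "R i \<inter> (Z \<inter> Z') \<noteq> {}"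
          using card_indices_submodular(2)[of i k R Z Z'] i ZF(2) Z'(2) unfolding p_def by linarith
        moreover have "p (Z \<inter> Z') + d (Z \<inter> Z') = k"
          using card_indices_submodular(1)[of k R Z Z'] d_mod[OF ZF(1) Z'(1)]
            cond'[OF ZZ(1)] cond'[OF ZZ(2)] ZF(3) tight unfolding p_def by linarith
        ultimately have "Z \<inter> Z' \<in> Bad" using ZZ(1) e te by (auto simp: Bad_def)
        then have "Z \<inter> Z' = Z" using Z(2) by blast
        then show False using e(4) te(2) by blast
      qed
      then show ?thesis using e by (intro bexI[of _ e]) (auto simp: leaving_def)
    qed
    then obtain e where e: "e \<in> leaving E t h X0"
      and ok: "\<And>Z. Z \<in> F \<Longrightarrow> R i \<inter> Z \<noteq> {} \<Longrightarrow> e \<in> leaving E t h Z \<Longrightarrow> p Z + d Z > k" by blast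
    have eE: "e \<in> E" "t e \<in> X0" "h e \<notin> X0" using e by (auto simp: leaving_def)
    define R' where "R' = R(i := insert (t e) (R i))"
    have leav: "leaving (E - {e}) t h X = leaving E t h X - {e}" for X by (auto simp: leaving_def)
    have "\<exists>col :: 'a \<Rightarrow> nat. \<forall>X\<in>F. \<forall>i<k. R' i \<inter> X = {} \<longrightarrow> (\<exists>e\<in>leaving (E - {e}) t h X. col e = i)"
    proof (rule less.hyps)
      show "card (E - {e}) < card E" using fin eE(1) by (rule card_Diff1_less)
      fix X assume X: "X \<in> F"
      define p' where "p' = card {i. i < k \<and> R' i \<inter> X \<noteq> {}}"
      have mono: "p X \<le> p'" unfolding p_def p'_def by (rule card_mono) (auto simp: R'_def)
      have "k \<le> p' + card (leaving E t h X - {e})"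
      proof (cases "e \<in> leaving E t h X")
        case False
        then show ?thesis using cond'[OF X] mono by (simp add: d_def)
      next
        case True
        then have cd: "Suc (card (leaving E t h X - {e})) = d X" unfolding d_def
          by (intro card_Suc_Diff1 finite_leaving fin)
        show ?thesis
        proof (cases "R i \<inter> X = {}")
          case True
          have "p X < p'" unfolding p_def p'_def
            by (rule psubset_card_mono)
              (use True i \<open>e \<in> leaving E t h X\<close> in \<open>auto simp: R'_def leaving_def\<close>)
          then show ?thesis using cond'[OF X] cd by linarith
        next
          case False
          then show ?thesis using ok[OF X] \<open>e \<in> leaving E t h X\<close> mono cd by fastforce
        qed
      qed
      then show "k \<le> card {i. i < k \<and> R' i \<inter> X \<noteq> {}} + card (leaving (E - {e}) t h X)"
        by (simp only: p'_def leav)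
    qed (use fin noenter in auto)
    then obtain col :: "'a \<Rightarrow> nat" where col:
      "\<And>X j. X \<in> F \<Longrightarrow> j < k \<Longrightarrow> R' j \<inter> X = {} \<Longrightarrow> \<exists>e'\<in>leaving E t h X - {e}. col e' = j"
      unfolding leav by metis
    have "\<exists>e'\<in>leaving E t h X. (col(e := i)) e' = j" if X: "X \<in> F" "j < k" "R j \<inter> X = {}" for X j
    proof (cases "R' j \<inter> X = {}")
      case True
      then show ?thesis using col[OF X(1,2)] by fastforce
    next
      case False
      then have j: "j = i" and te: "t e \<in> X" using X(3) by (auto simp: R'_def split: if_splits)
      have "h e \<notin> X" using X0_max[OF X(1)] X(3) j eE(3) by blast
      then have "e \<in> leaving E t h X" using te eE by (simp add: leaving_def)
      then show ?thesis using j by (intro bexI[of _ e]) simp_all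
    qed
    then show ?thesis by blast
  qed
qed

definition sees_colours ::
    "nat \<Rightarrow> 'a set \<Rightarrow> ('a \<Rightarrow> 'v) \<Rightarrow> ('a \<Rightarrow> 'v) \<Rightarrow> 'v set set \<Rightarrow> ('a \<Rightarrow> nat) \<Rightarrow> bool" where
  "sees_colours k E t h F col \<longleftrightarrow> (\<forall>X\<in>F. \<forall>i<k. \<exists>e\<in>leaving E t h X. col e = i)"

text \<open>
  If no arc has its head, and none its tail, in both an out-shore and an in-shore, the arcs fall into three classes:
  \<open>I1\<close>, with head in an out-shore, irrelevant for \<open>F2\<close>; \<open>I2\<close>, with tail in an in-shore, irrelevant for
  \<open>F1\<close>; and the rest \<open>A\<close>. An arc of \<open>A\<close> leaves every out-shore that contains its tail, so the colours
  on \<open>A\<close> required for the completion by \<open>extend_root_sets\<close> are given by a supermodular function.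
\<close>

lemma bibranching_colouring:
  fixes E :: "'a set" and t h :: "'a \<Rightarrow> 'v"
  assumes fin: "finite E" and lat1: "lattice_family F1" and lat2: "lattice_family F2"
    and ne1: "\<And>X e. X \<in> F1 \<Longrightarrow> e \<in> E \<Longrightarrow> h e \<in> X \<Longrightarrow> t e \<in> X"
    and ne2: "\<And>Y e. Y \<in> F2 \<Longrightarrow> e \<in> E \<Longrightarrow> t e \<in> Y \<Longrightarrow> h e \<in> Y"
    and sep_h: "\<And>e. e \<in> E \<Longrightarrow> h e \<in> \<Union>F1 \<Longrightarrow> h e \<notin> \<Union>F2"
    and sep_t: "\<And>e. e \<in> E \<Longrightarrow> t e \<in> \<Union>F1 \<Longrightarrow> t e \<notin> \<Union>F2"
    and d1: "\<And>X. X \<in> F1 \<Longrightarrow> k \<le> card (leaving E t h X)"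
    and d2: "\<And>Y. Y \<in> F2 \<Longrightarrow> k \<le> card (leaving E h t Y)"
  shows "\<exists>col. sees_colours k E t h F1 col \<and> sees_colours k E h t F2 col"
proof (cases "k = 0")
  case True
  then show ?thesis by (simp add: sees_colours_def)
next
  case False
  define A where "A = {e \<in> E. h e \<notin> \<Union>F1 \<and> t e \<notin> \<Union>F2}"
  define I1 where "I1 = {e \<in> E. h e \<in> \<Union>F1}"
  define I2 where "I2 = {e \<in> E. t e \<in> \<Union>F2}"
  have fins: "finite A" "finite I1" "finite I2" using fin by (auto simp: A_def I1_def I2_def)
  have disj: "I1 \<inter> I2 = {}"
  proof (rule ccontr)
    assume "I1 \<inter> I2 \<noteq> {}"
    then obtain e where e: "e \<in> E" "h e \<in> \<Union>F1" "t e \<in> \<Union>F2" by (auto simp: I1_def I2_def)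
    then have "t e \<in> \<Union>F1" using ne1 by blast
    then show False using sep_t e by blast
  qed
  have split1: "leaving E t h X = arcs_at A t X \<union> leaving I1 t h X" if "X \<in> F1" for X
    using that sep_t by (auto simp: leaving_def A_def I1_def)
  have split2: "leaving E h t X = arcs_at A h X \<union> leaving I2 h t X" if "X \<in> F2" for X
    using that sep_h by (auto simp: leaving_def A_def I2_def)
  define g1 where "g1 X = int k - int (card (leaving I1 t h X))" for X
  define g2 where "g2 X = int k - int (card (leaving I2 h t X))" for X
  have net1: "int (card (leaving I1 t h X)) = net I1 t h X" if "\<And>e. e \<in> I1 \<Longrightarrow> h e \<in> X \<Longrightarrow> t e \<in> X" for X
    by (rule card_leaving_eq_net[OF fins(2) that])
  have net2: "int (card (leaving I2 h t X)) = net I2 h t X" if "\<And>e. e \<in> I2 \<Longrightarrow> t e \<in> X \<Longrightarrow> h e \<in> X" for X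
    by (rule card_leaving_eq_net[OF fins(3) that])
  have sup1: "supermodular_on F1 g1"
    unfolding supermodular_on_def
  proof (intro ballI impI)
    fix X Y assume XY: "X \<in> F1" "Y \<in> F1"
    have *: "t e \<in> Z" if "e \<in> I1" "h e \<in> Z" "Z \<in> {X, Y, X \<inter> Y, X \<union> Y}" for e Z
      using that XY ne1 unfolding I1_def by blast
    have "int (card (leaving I1 t h Z)) = net I1 t h Z" if "Z \<in> {X, Y, X \<inter> Y, X \<union> Y}" for Z
      by (rule net1) (use * that in blast)
    then show "g1 X + g1 Y \<le> g1 (X \<inter> Y) + g1 (X \<union> Y)"
      using net_Un_Int[of I1 t h X Y] by (simp add: g1_def)
  qed
  have sup2: "supermodular_on F2 g2"
    unfolding supermodular_on_def
  proof (intro ballI impI)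
    fix X Y assume XY: "X \<in> F2" "Y \<in> F2"
    have *: "h e \<in> Z" if "e \<in> I2" "t e \<in> Z" "Z \<in> {X, Y, X \<inter> Y, X \<union> Y}" for e Z
      using that XY ne2 unfolding I2_def by blast
    have "int (card (leaving I2 h t Z)) = net I2 h t Z" if "Z \<in> {X, Y, X \<inter> Y, X \<union> Y}" for Z
      by (rule net2) (use * that in blast)
    then show "g2 X + g2 Y \<le> g2 (X \<inter> Y) + g2 (X \<union> Y)"
      using net_Un_Int[of I2 h t X Y] by (simp add: g2_def)
  qed
  have bd1: "g1 X \<le> int k \<and> g1 X \<le> int (card (arcs_at A t X))" if "X \<in> F1" for X
    using d1[OF that] card_Un_le[of "arcs_at A t X" "leaving I1 t h X"]
    unfolding split1[OF that] g1_def by linarith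
  have bd2: "g2 X \<le> int k \<and> g2 X \<le> int (card (arcs_at A h X))" if "X \<in> F2" for X
    using d2[OF that] card_Un_le[of "arcs_at A h X" "leaving I2 h t X"]
    unfolding split2[OF that] g2_def by linarith
  obtain c0 :: "'a \<Rightarrow> nat" where c0: "c0 ` A \<subseteq> {..<k}"
    "\<forall>X\<in>F1. g1 X \<le> int (card (c0 ` arcs_at A t X))"
    "\<forall>X\<in>F2. g2 X \<le> int (card (c0 ` arcs_at A h X))"
    using supermodular_colouring[OF fins(1) lat1 lat2 sup1 sup2 bd1 bd2] False by auto
  have root: "{i. i < k \<and> s ` {e \<in> A. c0 e = i} \<inter> X \<noteq> {}} = c0 ` arcs_at A s X" for s X
    using c0(1) by auto
  have "\<exists>c :: 'a \<Rightarrow> nat. \<forall>X\<in>F1. \<forall>i<k. t ` {e \<in> A. c0 e = i} \<inter> X = {} \<longrightarrow> (\<exists>e\<in>leaving I1 t h X. c e = i)"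
  proof (rule extend_root_sets[OF fins(2) lat1])
    fix X assume X: "X \<in> F1"
    show "k \<le> card {i. i < k \<and> t ` {e \<in> A. c0 e = i} \<inter> X \<noteq> {}} + card (leaving I1 t h X)"
      using bspec[OF c0(2) X] unfolding root g1_def by linarith
  qed (use ne1 in \<open>auto simp: I1_def\<close>)
  then obtain c1 :: "'a \<Rightarrow> nat" where c1:
    "\<forall>X\<in>F1. \<forall>i<k. t ` {e \<in> A. c0 e = i} \<inter> X = {} \<longrightarrow> (\<exists>e\<in>leaving I1 t h X. c1 e = i)" by (elim exE)
  have "\<exists>c :: 'a \<Rightarrow> nat. \<forall>X\<in>F2. \<forall>i<k. h ` {e \<in> A. c0 e = i} \<inter> X = {} \<longrightarrow> (\<exists>e\<in>leaving I2 h t X. c e = i)"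
  proof (rule extend_root_sets[OF fins(3) lat2])
    fix X assume X: "X \<in> F2"
    show "k \<le> card {i. i < k \<and> h ` {e \<in> A. c0 e = i} \<inter> X \<noteq> {}} + card (leaving I2 h t X)"
      using bspec[OF c0(3) X] unfolding root g2_def by linarith
  qed (use ne2 in \<open>auto simp: I2_def\<close>)
  then obtain c2 :: "'a \<Rightarrow> nat" where c2:
    "\<forall>X\<in>F2. \<forall>i<k. h ` {e \<in> A. c0 e = i} \<inter> X = {} \<longrightarrow> (\<exists>e\<in>leaving I2 h t X. c2 e = i)" by (elim exE)
  define col where "col e = (if e \<in> I1 then c1 e else if e \<in> I2 then c2 e else c0 e)" for e
  have colA: "col e = c0 e" if "e \<in> A" for e using that by (auto simp: col_def A_def I1_def I2_def)
  have col1: "col e = c1 e" if "e \<in> leaving I1 t h X" for e X using that by (auto simp: col_def leaving_def)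
  have col2: "col e = c2 e" if "e \<in> leaving I2 h t X" for e X
    using that disj by (auto simp: col_def leaving_def)
  have "\<exists>e\<in>leaving E t h X. col e = i" if X: "X \<in> F1" "i < k" for X i
  proof (cases "t ` {e \<in> A. c0 e = i} \<inter> X = {}")
    case True
    then obtain e where e: "e \<in> leaving I1 t h X" "c1 e = i"
      using c1[rule_format, OF X] by blast
    then have "col e = i" using col1[OF e(1)] by simp
    then show ?thesis using e(1) unfolding split1[OF X(1)] by blast
  next
    case False
    then obtain e where e: "e \<in> A" "c0 e = i" "t e \<in> X" by blast
    then have "col e = i" "e \<in> arcs_at A t X" using colA by simp_all
    then show ?thesis unfolding split1[OF X(1)] by blast
  qed
  moreover have "\<exists>e\<in>leaving E h t X. col e = i" if X: "X \<in> F2" "i < k" for X i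
  proof (cases "h ` {e \<in> A. c0 e = i} \<inter> X = {}")
    case True
    then obtain e where e: "e \<in> leaving I2 h t X" "c2 e = i"
      using c2[rule_format, OF X] by blast
    then have "col e = i" using col2[OF e(1)] by simp
    then show ?thesis using e(1) unfolding split2[OF X(1)] by blast
  next
    case False
    then obtain e where e: "e \<in> A" "c0 e = i" "h e \<in> X" by blast
    then have "col e = i" "e \<in> arcs_at A h X" using colA by simp_all
    then show ?thesis unfolding split2[OF X(1)] by blast
  qed
  ultimately show ?thesis unfolding sees_colours_def by blast
qed

section \<open>Finite systems of dicuts\<close>

text \<open>
  \<open>F1\<close> consists of out-shores and \<open>F2\<close> of in-shores. Reversing all arcs exchanges the two, which
  is the symmetry used throughout.
\<close>

definition dicut_system :: "'a set \<Rightarrow> ('a \<Rightarrow> 'v) \<Rightarrow> ('a \<Rightarrow> 'v) \<Rightarrow> 'v set set \<Rightarrow> 'v set set \<Rightarrow> bool" where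
  "dicut_system E t h F1 F2 \<longleftrightarrow> finite E \<and> lattice_family F1 \<and> lattice_family F2 \<and>
     (\<forall>X\<in>F1. \<forall>Y\<in>F2. X - Y \<in> F1 \<and> Y - X \<in> F2) \<and>
     (\<forall>X\<in>F1. \<forall>e\<in>E. h e \<in> X \<longrightarrow> t e \<in> X) \<and> (\<forall>Y\<in>F2. \<forall>e\<in>E. t e \<in> Y \<longrightarrow> h e \<in> Y)"

lemma dicut_system_swap: "dicut_system E t h F1 F2 \<Longrightarrow> dicut_system E h t F2 F1"
  by (simp add: dicut_system_def)

lemma dicut_systemD:
  assumes "dicut_system E t h F1 F2"
  shows "finite E" "lattice_family F1" "lattice_family F2"
    "X \<in> F1 \<Longrightarrow> Y \<in> F2 \<Longrightarrow> X - Y \<in> F1" "X \<in> F1 \<Longrightarrow> Y \<in> F2 \<Longrightarrow> Y - X \<in> F2"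
    "X \<in> F1 \<Longrightarrow> e \<in> E \<Longrightarrow> h e \<in> X \<Longrightarrow> t e \<in> X" "Y \<in> F2 \<Longrightarrow> e \<in> E \<Longrightarrow> t e \<in> Y \<Longrightarrow> h e \<in> Y"
  using assms by (auto simp: dicut_system_def)

lemma lattice_family_restrict:
  assumes "lattice_family F" and "\<And>X Y. P X \<Longrightarrow> P Y \<Longrightarrow> P (X \<union> Y)" and "\<And>X Y. P X \<Longrightarrow> P Y \<Longrightarrow> P (X \<inter> Y)"
  shows "lattice_family {X \<in> F. P X}"
  using assms by (simp add: lattice_family_def)

lemma dicut_system_restrict:
  assumes "dicut_system E t h F1 F2"
    and "\<And>X Y. P X \<Longrightarrow> P Y \<Longrightarrow> P (X \<union> Y)" "\<And>X Y. P X \<Longrightarrow> P Y \<Longrightarrow> P (X \<inter> Y)"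
    and "\<And>X Y. Q X \<Longrightarrow> Q Y \<Longrightarrow> Q (X \<union> Y)" "\<And>X Y. Q X \<Longrightarrow> Q Y \<Longrightarrow> Q (X \<inter> Y)"
    and "\<And>X Y. P X \<Longrightarrow> Q Y \<Longrightarrow> P (X - Y) \<and> Q (Y - X)"
  shows "dicut_system E t h {X \<in> F1. P X} {Y \<in> F2. Q Y}"
proof -
  have "lattice_family {X \<in> F1. P X}" "lattice_family {Y \<in> F2. Q Y}"
    using assms(1) by (auto simp: dicut_system_def intro!: lattice_family_restrict assms(2-5))
  then show ?thesis using assms(1,6) by (simp add: dicut_system_def)
qed

abbreviation dijoin_colourable :: "nat \<Rightarrow> 'a set \<Rightarrow> ('a \<Rightarrow> 'v) \<Rightarrow> ('a \<Rightarrow> 'v) \<Rightarrow> 'v set set \<Rightarrow> 'v set set \<Rightarrow> bool" where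
  "dijoin_colourable k E t h F1 F2 \<equiv> (\<exists>col. sees_colours k E t h F1 col \<and> sees_colours k E h t F2 col)"

lemma sees_colours_mono:
  assumes "sees_colours k E t h F col"
    and "\<And>X. X \<in> G \<Longrightarrow> \<exists>Z\<in>F. leaving E t h Z \<subseteq> leaving E' t h X"
  shows "sees_colours k E' t h G col"
  unfolding sees_colours_def
proof (intro ballI allI impI)
  fix X i assume "X \<in> G" "i < k"
  obtain Z where Z: "Z \<in> F" "leaving E t h Z \<subseteq> leaving E' t h X" using assms(2)[OF \<open>X \<in> G\<close>] by blast
  then obtain e where "e \<in> leaving E t h Z" "col e = i"
    using assms(1) \<open>i < k\<close> unfolding sees_colours_def by blast
  then show "\<exists>e\<in>leaving E' t h X. col e = i" using Z(2) by blast
qed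

text \<open>
  Each colour occurs exactly once on a cut with \<open>k\<close> arcs. If an out-shore \<open>Z\<close> crosses \<open>X\<close>, then for every
  colour the number of its arcs in \<open>Z\<close> plus \<open>1\<close> is the sum of the numbers for \<open>Z \<inter> X\<close> and
  \<open>Z \<union> X\<close>, which are both positive; an in-shore \<open>Y\<close> is treated in the same way with \<open>X - Y\<close> and
  \<open>Y - X\<close>.
\<close>

lemma glue_colourings:
  fixes t h :: "'a \<Rightarrow> 'v"
  assumes sys: "dicut_system E t h F1 F2" and X: "X \<in> F1" and tight: "card (leaving E t h X) = k"
    and col1: "sees_colours k E t h {Z\<in>F1. X \<subseteq> Z \<or> Z \<inter> X = {}} col1"
      "sees_colours k E h t {Y\<in>F2. Y \<inter> X = {}} col1"
    and col2: "sees_colours k E t h {Z\<in>F1. Z \<subseteq> X} col2"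
  shows "dijoin_colourable k E t h F1 F2"
proof -
  define L where "L = leaving E t h X"
  note fin = dicut_systemD(1)[OF sys] and lat1 = dicut_systemD(2)[OF sys] and lat2 = dicut_systemD(3)[OF sys]
  have finL: "finite L" "card L = k" using tight fin by (simp_all add: L_def leaving_def)
  have bij: "bij_betw c L {..<k}" if "{..<k} \<subseteq> c ` L" for c :: "'a \<Rightarrow> nat"
  proof -
    have "card (c ` L) \<le> k" using card_image_le[OF finL(1)] finL(2) by blast
    then have "c ` L = {..<k}" using that finL(1)
      by (intro card_seteq[symmetric]) auto
    moreover have "inj_on c L" using calculation finL by (intro eq_card_imp_inj_on) auto
    ultimately show ?thesis by (simp add: bij_betw_def)
  qed
  have seen: "{..<k} \<subseteq> c ` L" if "sees_colours k E t h F c" "X \<in> F" for F c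
    using that unfolding sees_colours_def L_def by force
  have b1: "bij_betw col1 L {..<k}" by (rule bij, rule seen[OF col1(1)]) (use X in simp)
  have b2: "bij_betw col2 L {..<k}" by (rule bij, rule seen[OF col2]) (use X in simp)
  \<comment> \<open>the permutation of the colours after which both colourings agree on the tight cut\<close>
  define \<sigma> where "\<sigma> = col1 \<circ> inv_into L col2"
  have \<sigma>: "bij_betw \<sigma> {..<k} {..<k}"
    unfolding \<sigma>_def by (rule bij_betw_trans[OF bij_betw_inv_into[OF b2] b1])
  have \<sigma>L: "\<sigma> (col2 e) = col1 e" if "e \<in> L" for e
    using that b2 by (simp add: \<sigma>_def bij_betw_def)
  define col where "col e = (if t e \<in> X then if h e \<in> X then \<sigma> (col2 e) else col1 e else col1 e)" for e
  have inner: "col e = \<sigma> (col2 e)" if "e \<in> E" "t e \<in> X" for e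
    using that \<sigma>L[of e] by (auto simp: col_def L_def leaving_def)
  have outer: "col e = col1 e" if "\<not> (t e \<in> X \<and> h e \<in> X)" for e
    using that by (auto simp: col_def)
  have P1: "\<exists>e\<in>leaving E t h Z. col e = i" if Z: "Z \<in> F1" "X \<subseteq> Z \<or> Z \<inter> X = {}" "i < k" for Z i
  proof -
    obtain e where e: "e \<in> leaving E t h Z" "col1 e = i"
      using col1(1) Z unfolding sees_colours_def by blast
    then have "\<not> (t e \<in> X \<and> h e \<in> X)" using Z(2) by (auto simp: leaving_def)
    then show ?thesis using e outer by auto
  qed
  have P1': "\<exists>e\<in>leaving E h t Y. col e = i" if Y: "Y \<in> F2" "Y \<inter> X = {}" "i < k" for Y i
  proof -
    obtain e where e: "e \<in> leaving E h t Y" "col1 e = i"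
      using col1(2) Y unfolding sees_colours_def by blast
    then have "\<not> (t e \<in> X \<and> h e \<in> X)" using Y(2) by (auto simp: leaving_def)
    then show ?thesis using e outer by auto
  qed
  have P2: "\<exists>e\<in>leaving E t h Z. col e = i" if Z: "Z \<in> F1" "Z \<subseteq> X" "i < k" for Z i
  proof -
    have "i \<in> \<sigma> ` {..<k}" using \<sigma> Z(3) by (simp add: bij_betw_def)
    then obtain j where j: "j < k" "\<sigma> j = i" by blast
    obtain e where e: "e \<in> leaving E t h Z" "col2 e = j"
      using col2 Z j unfolding sees_colours_def by blast
    then have "e \<in> E" "t e \<in> X" using Z(2) by (auto simp: leaving_def)
    then show ?thesis using e inner j by auto
  qed
  define C where "C i = {e \<in> E. col e = i}" for i
  have finC: "finite (C i)" for i using fin by (simp add: C_def)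
  have leavC: "leaving (C i) s s' Z = {e \<in> leaving E s s' Z. col e = i}" for i s s' and Z :: "'v set"
    by (auto simp: C_def leaving_def)
  have net1: "int (card (leaving (C i) t h Z)) = net (C i) t h Z" if "Z \<in> F1" for i Z
    by (rule card_leaving_eq_net[OF finC]) (use dicut_systemD(6)[OF sys that] in \<open>auto simp: C_def\<close>)
  have net2: "int (card (leaving (C i) h t Z)) = net (C i) h t Z" if "Z \<in> F2" for i Z
    by (rule card_leaving_eq_net[OF finC]) (use dicut_systemD(7)[OF sys that] in \<open>auto simp: C_def\<close>)
  have pos: "1 \<le> int (card (leaving (C i) s s' Z)) \<longleftrightarrow> (\<exists>e\<in>leaving E s s' Z. col e = i)"
    for i s s' and Z :: "'v set"
  proof -
    have "finite (leaving (C i) s s' Z)" by (rule finite_leaving[OF finC])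
    then have "0 < card (leaving (C i) s s' Z) \<longleftrightarrow> leaving (C i) s s' Z \<noteq> {}"
      by (simp add: card_gt_0_iff)
    then have "1 \<le> int (card (leaving (C i) s s' Z)) \<longleftrightarrow> leaving (C i) s s' Z \<noteq> {}"
      by linarith
    also have "\<dots> \<longleftrightarrow> (\<exists>e\<in>leaving E s s' Z. col e = i)" unfolding leavC by auto
    finally show ?thesis .
  qed
  have oneX: "int (card (leaving (C i) t h X)) \<le> 1" for i
  proof -
    have "e = e'" if "e \<in> leaving (C i) t h X" "e' \<in> leaving (C i) t h X" for e e'
    proof -
      have "e \<in> L" "e' \<in> L" "col e = col e'" using that by (auto simp: leavC L_def)
      moreover have "\<not> (t e \<in> X \<and> h e \<in> X)" "\<not> (t e' \<in> X \<and> h e' \<in> X)"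
        using that by (simp_all add: leaving_def)
      ultimately have "e \<in> L" "e' \<in> L" "col1 e = col1 e'" using outer[of e] outer[of e'] by simp_all
      then show ?thesis using bij_betw_imp_inj_on[OF b1] by (meson inj_onD)
    qed
    then have "card (leaving (C i) t h X) \<le> Suc 0" using card_le_Suc0_iff_eq[OF finite_leaving[OF finC]] by blast
    then show ?thesis by simp
  qed
  have "\<exists>e\<in>leaving E t h Z. col e = i" if Z: "Z \<in> F1" "i < k" for Z i
  proof (cases "Z \<inter> X = {}")
    case True
    then show ?thesis using P1 Z by blast
  next
    case False
    then have mem: "Z \<inter> X \<in> F1" "Z \<union> X \<in> F1" using lattice_familyD(3,4)[OF lat1 Z(1) X] by blast+
    have "1 \<le> int (card (leaving (C i) t h (Z \<inter> X)))" "1 \<le> int (card (leaving (C i) t h (Z \<union> X)))"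
      unfolding pos using P2[OF mem(1) _ Z(2)] P1[OF mem(2) _ Z(2)] by blast+
    then have "1 \<le> int (card (leaving (C i) t h Z))"
      using net_Un_Int[of "C i" t h Z X] oneX[of i] net1[OF Z(1), of i] net1[OF X, of i]
        net1[OF mem(1), of i] net1[OF mem(2), of i] by linarith
    then show ?thesis unfolding pos .
  qed
  moreover have "\<exists>e\<in>leaving E h t Y. col e = i" if Y: "Y \<in> F2" "i < k" for Y i
  proof -
    have mem: "X - Y \<in> F1" "Y - X \<in> F2" using dicut_systemD(4,5)[OF sys X Y(1)] by blast+
    have "1 \<le> int (card (leaving (C i) t h (X - Y)))" "1 \<le> int (card (leaving (C i) h t (Y - X)))"
      unfolding pos using P2[OF mem(1) _ Y(2)] P1'[OF mem(2) _ Y(2)] by blast+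
    then have "1 \<le> int (card (leaving (C i) h t Y))"
      using net_Diff[of "C i" t h X Y] net_swap[of "C i" h t Y] net_swap[of "C i" h t "Y - X"]
        oneX[of i] net2[OF Y(1), of i] net1[OF X, of i]
        net1[OF mem(1), of i] net2[OF mem(2), of i] by linarith
    then show ?thesis unfolding pos .
  qed
  ultimately show ?thesis unfolding sees_colours_def by blast
qed

text \<open>
  Both parts have fewer shores than the whole. The inner part, with the out-shores inside \<open>X\<close>, has no
  in-shores at all. The outer part lacks \<open>X - Y\<close>, which is a non-empty proper subset of \<open>X\<close>
  because \<open>X\<close> and \<open>Y\<close> have a common vertex.
\<close>

lemma tight_decomposition:
  fixes t h :: "'a \<Rightarrow> 'v"
  assumes sys: "dicut_system E t h F1 F2" and X: "X \<in> F1" and tight: "card (leaving E t h X) = k"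
    and Y: "Y \<in> F2" "X \<inter> Y \<noteq> {}"
    and IH: "\<And>G1 G2. G1 \<subseteq> F1 \<Longrightarrow> G2 \<subseteq> F2 \<Longrightarrow> card G1 + card G2 < card F1 + card F2 \<Longrightarrow>
      dicut_system E t h G1 G2 \<Longrightarrow> dijoin_colourable k E t h G1 G2"
  shows "dijoin_colourable k E t h F1 F2"
proof -
  note lat1 = dicut_systemD(2)[OF sys] and lat2 = dicut_systemD(3)[OF sys]
  have finF: "finite F1" "finite F2" using lattice_familyD(1) lat1 lat2 by auto
  let ?G = "{Z\<in>F1. X \<subseteq> Z \<or> Z \<inter> X = {}}" and ?H = "{Y\<in>F2. Y \<inter> X = {}}" and ?I = "{Z\<in>F1. Z \<subseteq> X}"
  have XY: "X - Y \<in> F1" using dicut_systemD(4)[OF sys X Y(1)] .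
  then have "X - Y \<noteq> {}" using lattice_familyD(2)[OF lat1] by metis
  then have "(X - Y) \<inter> X \<noteq> {}" by blast
  moreover have "\<not> X \<subseteq> X - Y" using Y(2) by blast
  ultimately have nG: "X - Y \<notin> ?G" by simp
  have "?G \<subset> F1"
  proof (rule psubsetI)
    show "?G \<noteq> F1"
    proof
      assume "?G = F1"
      then show False using XY nG by (simp only: not_True_eq_False)
    qed
  qed (rule Collect_restrict)
  then have "card ?G < card F1" using finF by (simp add: psubset_card_mono)
  moreover have "card ?H \<le> card F2" using finF by (intro card_mono) auto
  ultimately have c1: "card ?G + card ?H < card F1 + card F2" by linarith
  have "card F2 > 0" using Y(1) finF card_gt_0_iff by blast
  moreover have "card ?I \<le> card F1" using finF by (intro card_mono) auto
  ultimately have c2: "card ?I + card ({} :: 'v set set) < card F1 + card F2" by simp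
  have s1: "dicut_system E t h ?G ?H" by (rule dicut_system_restrict[OF sys]) blast+
  have "dicut_system E t h ?I {Y \<in> F2. False}" by (rule dicut_system_restrict[OF sys]) blast+
  then have s2: "dicut_system E t h ?I {}" by simp
  have "dijoin_colourable k E t h ?G ?H" by (rule IH[OF _ _ c1 s1]; blast)
  then obtain col1 where col1: "sees_colours k E t h ?G col1" "sees_colours k E h t ?H col1"
    by (elim exE conjE)
  have "dijoin_colourable k E t h ?I {}" by (rule IH[OF _ _ c2 s2]; blast)
  then obtain col2 where col2: "sees_colours k E t h ?I col2" by (elim exE conjE)
  show ?thesis by (rule glue_colourings[OF sys X tight col1 col2])
qed

text \<open>
  From \<open>X\<close> the least in-shores around the offending tails are removed. Their union \<open>W\<close> contains no head
  of an arc in an out-shore, by the hypothesis, so no arc of \<open>X - W\<close> ends in \<open>X \<inter> W\<close> and the new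
  cut is part of the old one.
\<close>

lemma pure_shores_suffice:
  fixes t h :: "'a \<Rightarrow> 'v"
  assumes sys: "dicut_system E t h F1 F2" and X: "X \<in> F1"
    and no_pair: "\<And>e e'. e \<in> E \<Longrightarrow> e' \<in> E \<Longrightarrow> h e \<in> \<Union>F1 \<Longrightarrow> t e' \<in> \<Union>F1 \<Longrightarrow> t e' \<in> \<Union>F2 \<Longrightarrow>
      \<exists>Y\<in>F2. t e' \<in> Y \<and> h e \<notin> Y"
  shows "\<exists>Z\<in>F1. (\<forall>e\<in>E. t e \<in> Z \<longrightarrow> t e \<notin> \<Union>F2) \<and> leaving E t h Z \<subseteq> leaving E t h X"
proof -
  note lat1 = dicut_systemD(2)[OF sys] and lat2 = dicut_systemD(3)[OF sys]
  define least_shore where "least_shore m = \<Inter>{Y\<in>F2. m \<in> Y}" for m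
  have least_shore: "least_shore m \<in> F2" "m \<in> least_shore m" if "m \<in> \<Union>F2" for m
  proof -
    have "least_shore m \<in> {Y\<in>F2. m \<in> Y}" unfolding least_shore_def
      by (rule Inter_lattice) (use that lattice_familyD(1,4)[OF lat2] in auto)
    then show "least_shore m \<in> F2" "m \<in> least_shore m" by auto
  qed
  define W where "W = \<Union>(least_shore ` {t e | e. e \<in> E \<and> t e \<in> X \<and> t e \<in> \<Union>F2})"
  show ?thesis
  proof (cases "{t e | e. e \<in> E \<and> t e \<in> X \<and> t e \<in> \<Union>F2} = {}")
    case True
    then show ?thesis using X by blast
  next
    case False
    have "W \<in> F2"
    proof -
      have fin: "finite {t e | e. e \<in> E \<and> t e \<in> X \<and> t e \<in> \<Union>F2}"
        using dicut_systemD(1)[OF sys] by simp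
      have "\<Union>(least_shore ` S) \<in> F2" if "finite S" "S \<noteq> {}" "S \<subseteq> \<Union>F2" for S
        using that
      proof (induction S rule: finite_ne_induct)
        case (singleton m)
        then show ?case using least_shore(1) by simp
      next
        case (insert m S)
        then show ?case using least_shore(1)[of m] lattice_familyD(3)[OF lat2] by simp
      qed
      then show ?thesis unfolding W_def using fin False by blast
    qed
    then have XW: "X - W \<in> F1" by (rule dicut_systemD(4)[OF sys X])
    moreover have "t e \<notin> \<Union>F2" if "e \<in> E" "t e \<in> X - W" for e
    proof
      assume m: "t e \<in> \<Union>F2"
      then have "t e \<in> W" using that least_shore(2) unfolding W_def by blast
      then show False using that by blast
    qed
    moreover have "leaving E t h (X - W) \<subseteq> leaving E t h X"
    proof
      fix e assume e: "e \<in> leaving E t h (X - W)"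
      have "h e \<notin> X"
      proof
        assume hX: "h e \<in> X"
        then obtain e' where e': "e' \<in> E" "t e' \<in> X" "t e' \<in> \<Union>F2" "h e \<in> least_shore (t e')"
          using e unfolding W_def leaving_def by blast
        then show False using no_pair[of e e'] e X hX unfolding least_shore_def leaving_def by blast
      qed
      then show "e \<in> leaving E t h X" using e by (simp add: leaving_def)
    qed
    ultimately show ?thesis by blast
  qed
qed

text \<open>
  The arc \<open>a\<close> enters the middle and \<open>b\<close> leaves it. Replacing both by one arc from the tail of
  \<open>a\<close> to the head of \<open>b\<close> removes an arc from the cut of \<open>X\<close> only if \<open>X\<close> contains the tail of \<open>b\<close> but
  not the head of \<open>a\<close>, and then \<open>X\<close> has an arc to spare. Conversely a colour on the merged arc is
  given back to both \<open>a\<close> and \<open>b\<close>, one of which lies in the cut whenever the merged arc does.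
\<close>

lemma merge_arcs_out_shores:
  fixes t h :: "'a \<Rightarrow> 'v"
  assumes sys: "dicut_system E t h F1 F2"
    and d1: "\<And>X. X \<in> F1 \<Longrightarrow> k \<le> card (leaving E t h X)"
    and d1': "\<And>X. X \<in> F1 \<Longrightarrow> X \<inter> \<Union>F2 \<noteq> {} \<Longrightarrow> k < card (leaving E t h X)"
    and a: "a \<in> E" "t a \<notin> \<Union>F2" "h a \<in> \<Union>F1"
    and b: "b \<in> E" "t b \<in> \<Union>F2" "h b \<notin> \<Union>F1" and "a \<noteq> b"
    and le: "\<And>X. X \<in> F1 \<Longrightarrow> h a \<in> X \<Longrightarrow> t b \<in> X"
    and X: "X \<in> F1"
  shows "k \<le> card (leaving (E - {a}) (t(b := t a)) h X)"
    and "e \<in> leaving (E - {a}) (t(b := t a)) h X \<Longrightarrow>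
      \<exists>e'\<in>leaving E t h X. (col(a := col b)) e' = col e"
proof -
  note fin = dicut_systemD(1)[OF sys]
  let ?t = "t(b := t a)"
  have "net E t h X = net (E - {a} - {b}) t h X + (of_bool (t a \<in> X) - of_bool (h a \<in> X))
      + (of_bool (t b \<in> X) - of_bool (h b \<in> X))"
    unfolding net_def using fin a(1) b(1) \<open>a \<noteq> b\<close>
    by (simp add: sum.remove[of E a] sum.remove[of "E - {a}" b])
  moreover have "net (E - {a}) ?t h X = net (E - {a} - {b}) t h X + (of_bool (t a \<in> X) - of_bool (h b \<in> X))"
    unfolding net_def using fin b(1) \<open>a \<noteq> b\<close> by (simp add: sum.remove[of "E - {a}" b])
  ultimately have "net (E - {a}) ?t h X = net E t h X - of_bool (t b \<in> X) + of_bool (h a \<in> X)" by linarith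
  moreover have "int (card (leaving E t h X)) = net E t h X"
    by (rule card_leaving_eq_net[OF fin]) (use dicut_systemD(6)[OF sys X] in blast)
  moreover have "int (card (leaving (E - {a}) ?t h X)) = net (E - {a}) ?t h X"
  proof (rule card_leaving_eq_net)
    fix e assume "e \<in> E - {a}" "h e \<in> X"
    moreover have "e \<noteq> b" using b(3) X \<open>h e \<in> X\<close> by blast
    ultimately show "?t e \<in> X" using dicut_systemD(6)[OF sys X] by simp
  qed (use fin in simp)
  ultimately have eq: "int (card (leaving (E - {a}) ?t h X)) =
      int (card (leaving E t h X)) - of_bool (t b \<in> X) + of_bool (h a \<in> X)" by linarith
  show "k \<le> card (leaving (E - {a}) ?t h X)"
  proof (cases "t b \<in> X \<and> h a \<notin> X")
    case True
    then have "k < card (leaving E t h X)" using d1'[OF X] b(2) by blast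
    then show ?thesis using eq True by simp
  next
    case False
    then show ?thesis using eq d1[OF X] le[OF X] by (cases "t b \<in> X"; cases "h a \<in> X") simp_all
  qed
  assume e: "e \<in> leaving (E - {a}) ?t h X"
  show "\<exists>e'\<in>leaving E t h X. (col(a := col b)) e' = col e"
  proof (cases "e = b")
    case False
    then have "e \<in> leaving E t h X" "e \<noteq> a" using e by (auto simp: leaving_def)
    then show ?thesis by (intro bexI[of _ e]) simp_all
  next
    case True
    then have ends: "t a \<in> X" "h b \<notin> X" using e by (auto simp: leaving_def)
    show ?thesis
    proof (cases "h a \<in> X")
      case False
      then have "a \<in> leaving E t h X" using ends a by (simp add: leaving_def)
      then show ?thesis using True by (intro bexI[of _ a]) simp_all
    next
      case h: True
      then have "b \<in> leaving E t h X" using le[OF X] ends b by (simp add: leaving_def)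
      then show ?thesis using True \<open>a \<noteq> b\<close> by (intro bexI[of _ b]) simp_all
    qed
  qed
qed

text \<open>
  The same for in-shores. It is not the mirror image of the previous lemma, since the merged arc is again
  represented by \<open>b\<close>.
\<close>

lemma merge_arcs_in_shores:
  fixes t h :: "'a \<Rightarrow> 'v"
  assumes sys: "dicut_system E t h F1 F2"
    and d2: "\<And>Y. Y \<in> F2 \<Longrightarrow> k \<le> card (leaving E h t Y)"
    and d2': "\<And>Y. Y \<in> F2 \<Longrightarrow> Y \<inter> \<Union>F1 \<noteq> {} \<Longrightarrow> k < card (leaving E h t Y)"
    and a: "a \<in> E" "t a \<notin> \<Union>F2" "h a \<in> \<Union>F1"
    and b: "b \<in> E" "t b \<in> \<Union>F2" "h b \<notin> \<Union>F1" and "a \<noteq> b"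
    and le: "\<And>Y. Y \<in> F2 \<Longrightarrow> t b \<in> Y \<Longrightarrow> h a \<in> Y"
    and Y: "Y \<in> F2"
  shows "k \<le> card (leaving (E - {a}) h (t(b := t a)) Y)"
    and "e \<in> leaving (E - {a}) h (t(b := t a)) Y \<Longrightarrow>
      \<exists>e'\<in>leaving E h t Y. (col(a := col b)) e' = col e"
proof -
  note fin = dicut_systemD(1)[OF sys]
  let ?t = "t(b := t a)"
  have "net E h t Y = net (E - {a} - {b}) h t Y + (of_bool (h a \<in> Y) - of_bool (t a \<in> Y))
      + (of_bool (h b \<in> Y) - of_bool (t b \<in> Y))"
    unfolding net_def using fin a(1) b(1) \<open>a \<noteq> b\<close>
    by (simp add: sum.remove[of E a] sum.remove[of "E - {a}" b])
  moreover have "net (E - {a}) h ?t Y = net (E - {a} - {b}) h t Y + (of_bool (h b \<in> Y) - of_bool (t a \<in> Y))"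
    unfolding net_def using fin b(1) \<open>a \<noteq> b\<close> by (simp add: sum.remove[of "E - {a}" b])
  ultimately have "net (E - {a}) h ?t Y = net E h t Y - of_bool (h a \<in> Y) + of_bool (t b \<in> Y)" by linarith
  moreover have "int (card (leaving E h t Y)) = net E h t Y"
    by (rule card_leaving_eq_net[OF fin]) (use dicut_systemD(7)[OF sys Y] in blast)
  moreover have "int (card (leaving (E - {a}) h ?t Y)) = net (E - {a}) h ?t Y"
  proof (rule card_leaving_eq_net)
    fix e assume "e \<in> E - {a}" "?t e \<in> Y"
    moreover have "e \<noteq> b" using a(2) Y \<open>?t e \<in> Y\<close> by (metis UnionI fun_upd_same)
    ultimately show "h e \<in> Y" using dicut_systemD(7)[OF sys Y] by simp
  qed (use fin in simp)
  ultimately have eq: "int (card (leaving (E - {a}) h ?t Y)) =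
      int (card (leaving E h t Y)) - of_bool (h a \<in> Y) + of_bool (t b \<in> Y)" by linarith
  show "k \<le> card (leaving (E - {a}) h ?t Y)"
  proof (cases "h a \<in> Y \<and> t b \<notin> Y")
    case True
    then have "k < card (leaving E h t Y)" using d2'[OF Y] a(3) by blast
    then show ?thesis using eq True by simp
  next
    case False
    then show ?thesis using eq d2[OF Y] le[OF Y] by (cases "h a \<in> Y"; cases "t b \<in> Y") simp_all
  qed
  assume e: "e \<in> leaving (E - {a}) h ?t Y"
  show "\<exists>e'\<in>leaving E h t Y. (col(a := col b)) e' = col e"
  proof (cases "e = b")
    case False
    then have "e \<in> leaving E h t Y" "e \<noteq> a" using e by (auto simp: leaving_def)
    then show ?thesis by (intro bexI[of _ e]) simp_all
  next
    case True
    then have ends: "t a \<notin> Y" "h b \<in> Y" using e by (auto simp: leaving_def)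
    show ?thesis
    proof (cases "t b \<in> Y")
      case False
      then have "b \<in> leaving E h t Y" using ends b by (simp add: leaving_def)
      then show ?thesis using True \<open>a \<noteq> b\<close> by (intro bexI[of _ b]) simp_all
    next
      case h: True
      then have "a \<in> leaving E h t Y" using le[OF Y] ends a by (simp add: leaving_def)
      then show ?thesis using True by (intro bexI[of _ a]) simp_all
    qed
  qed
qed

text \<open>
  The induction on the number of shores and arcs removes the middle, that is, the set \<open>?M\<close> of vertices
  in both an out-shore and an in-shore. Once no tight shore has a middle vertex, every step that takes
  at most one arc from the cuts of such shores is harmless. The step \<open>drop\<close> deletes an arc inside the
  middle and \<open>merge\<close> replaces an arc into the middle and one out of it by a single arc.
\<close>

theorem finite_source_sink_colouring:
  fixes t h :: "'a \<Rightarrow> 'v"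
  assumes "dicut_system E t h F1 F2"
    and "\<And>X. X \<in> F1 \<Longrightarrow> k \<le> card (leaving E t h X)"
    and "\<And>Y. Y \<in> F2 \<Longrightarrow> k \<le> card (leaving E h t Y)"
  shows "dijoin_colourable k E t h F1 F2"
  using assms
proof (induction "card F1 + card F2 + card E" arbitrary: E t h F1 F2 rule: less_induct)
  case less
  note sys = less.prems(1) and d1 = less.prems(2) and d2 = less.prems(3)
  note fin = dicut_systemD(1)[OF sys]
  have smaller: "dijoin_colourable k E t h G1 G2"
    if "G1 \<subseteq> F1" "G2 \<subseteq> F2" "card G1 + card G2 < card F1 + card F2" "dicut_system E t h G1 G2" for G1 G2
    by (rule less.hyps) (use that d1 d2 in auto)
  show ?case
  proof (cases "(\<exists>X\<in>F1. X \<inter> \<Union>F2 \<noteq> {} \<and> card (leaving E t h X) = k) \<or>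
      (\<exists>Y\<in>F2. Y \<inter> \<Union>F1 \<noteq> {} \<and> card (leaving E h t Y) = k)")
    case True
    then show ?thesis
    proof (elim disjE bexE conjE)
      fix X assume X: "X \<in> F1" "X \<inter> \<Union>F2 \<noteq> {}" "card (leaving E t h X) = k"
      then obtain Y where "Y \<in> F2" "X \<inter> Y \<noteq> {}" by blast
      then show ?thesis using tight_decomposition[OF sys X(1,3)] smaller by blast
    next
      fix Y assume Y: "Y \<in> F2" "Y \<inter> \<Union>F1 \<noteq> {}" "card (leaving E h t Y) = k"
      then obtain X where X: "X \<in> F1" "Y \<inter> X \<noteq> {}" by blast
      have "dijoin_colourable k E h t F2 F1"
      proof (rule tight_decomposition[OF dicut_system_swap[OF sys] Y(1,3) X])
        fix G1 G2 assume "G1 \<subseteq> F2" "G2 \<subseteq> F1" "card G1 + card G2 < card F2 + card F1" "dicut_system E h t G1 G2"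
        then have "dijoin_colourable k E t h G2 G1"
          by (intro smaller) (simp_all add: dicut_system_swap)
        then show "dijoin_colourable k E h t G1 G2" by blast
      qed
      then show ?thesis by blast
    qed
  next
    case False
    then have d1': "k < card (leaving E t h X)" if "X \<in> F1" "X \<inter> \<Union>F2 \<noteq> {}" for X
      using d1[OF that(1)] that by (metis le_neq_implies_less)
    have d2': "k < card (leaving E h t Y)" if "Y \<in> F2" "Y \<inter> \<Union>F1 \<noteq> {}" for Y
      using False d2[OF that(1)] that by (metis le_neq_implies_less)
    let ?M = "\<Union>F1 \<inter> \<Union>F2"
    have drop: "dijoin_colourable k E t h F1 F2" if a: "a \<in> E" "t a \<in> ?M" "h a \<in> ?M" for a
    proof -
      have leav: "leaving (E - {a}) s s' Z = leaving E s s' Z - {a}" for s s' and Z :: "'v set"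
        by (auto simp: leaving_def)
      have cd: "k \<le> card (L - {a})" if "k \<le> card L" "a \<in> L \<Longrightarrow> k < card L" for L
        using that by (cases "a \<in> L") (auto simp: card_Diff_singleton_if)
      have "dijoin_colourable k (E - {a}) t h F1 F2"
      proof (rule less.hyps)
        show "card F1 + card F2 + card (E - {a}) < card F1 + card F2 + card E"
          using card_Diff1_less[OF fin a(1)] by simp
        show "dicut_system (E - {a}) t h F1 F2" using sys by (simp add: dicut_system_def)
        show "k \<le> card (leaving (E - {a}) t h X)" if "X \<in> F1" for X
          unfolding leav by (rule cd[OF d1[OF that] d1'[OF that]]) (use a in \<open>auto simp: leaving_def\<close>)
        show "k \<le> card (leaving (E - {a}) h t Y)" if "Y \<in> F2" for Y
          unfolding leav by (rule cd[OF d2[OF that] d2'[OF that]]) (use a in \<open>auto simp: leaving_def\<close>)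
      qed
      then obtain col where col: "sees_colours k (E - {a}) t h F1 col" "sees_colours k (E - {a}) h t F2 col"
        by (elim exE conjE)
      have "sees_colours k E t h F1 col" by (rule sees_colours_mono[OF col(1)]) (auto simp: leav)
      moreover have "sees_colours k E h t F2 col" by (rule sees_colours_mono[OF col(2)]) (auto simp: leav)
      ultimately show ?thesis by blast
    qed
    have merge: "dijoin_colourable k E t h F1 F2"
      if a: "a \<in> E" "t a \<notin> ?M" "h a \<in> ?M" and b: "b \<in> E" "t b \<in> ?M" "h b \<notin> ?M"
        and le1: "\<And>X. X \<in> F1 \<Longrightarrow> h a \<in> X \<Longrightarrow> t b \<in> X" and le2: "\<And>Y. Y \<in> F2 \<Longrightarrow> t b \<in> Y \<Longrightarrow> h a \<in> Y" for a b
    proof -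
      let ?t = "t(b := t a)"
      \<comment> \<open>the head of the merged arc is in no out-shore and its tail in no in-shore, so it respects all shores\<close>
      have "t a \<in> \<Union>F1" using a(1,3) dicut_systemD(6)[OF sys] by blast
      then have ta: "t a \<notin> \<Union>F2" using a(2) by blast
      have "h b \<in> \<Union>F2" using b(1,2) dicut_systemD(7)[OF sys] by blast
      then have hb: "h b \<notin> \<Union>F1" using b(3) by blast
      have ab: "a \<noteq> b" using a b by blast
      have ha: "h a \<in> \<Union>F1" and tb: "t b \<in> \<Union>F2" using a b by blast+
      have m1: "k \<le> card (leaving (E - {a}) ?t h X)" if "X \<in> F1" for X
        by (rule merge_arcs_out_shores(1)[OF sys _ _ a(1) ta ha b(1) tb hb ab _ that]) (fact d1 d1' le1)+
      have m2: "k \<le> card (leaving (E - {a}) h ?t Y)" if "Y \<in> F2" for Y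
        by (rule merge_arcs_in_shores(1)[OF sys _ _ a(1) ta ha b(1) tb hb ab _ that]) (fact d2 d2' le2)+
      have lift1: "\<exists>e'\<in>leaving E t h X. (col(a := col b)) e' = col e"
        if "X \<in> F1" "e \<in> leaving (E - {a}) ?t h X" for X e and col :: "'a \<Rightarrow> nat"
        by (rule merge_arcs_out_shores(2)[OF sys _ _ a(1) ta ha b(1) tb hb ab _ that]) (fact d1 d1' le1)+
      have lift2: "\<exists>e'\<in>leaving E h t Y. (col(a := col b)) e' = col e"
        if "Y \<in> F2" "e \<in> leaving (E - {a}) h ?t Y" for Y e and col :: "'a \<Rightarrow> nat"
        by (rule merge_arcs_in_shores(2)[OF sys _ _ a(1) ta ha b(1) tb hb ab _ that]) (fact d2 d2' le2)+
      have "dijoin_colourable k (E - {a}) ?t h F1 F2"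
      proof (rule less.hyps)
        show "card F1 + card F2 + card (E - {a}) < card F1 + card F2 + card E"
          using card_Diff1_less[OF fin a(1)] by simp
        show "dicut_system (E - {a}) ?t h F1 F2"
          using sys hb ta unfolding dicut_system_def by auto
      qed (fact m1 m2)+
      then obtain col where col: "sees_colours k (E - {a}) ?t h F1 col" "sees_colours k (E - {a}) h ?t F2 col"
        by (elim exE conjE)
      have "sees_colours k E t h F1 (col(a := col b))"
        unfolding sees_colours_def
      proof (intro ballI allI impI)
        fix X i assume X: "X \<in> F1" "i < k"
        then obtain e where "e \<in> leaving (E - {a}) ?t h X" "col e = i"
          using col(1) unfolding sees_colours_def by blast
        then show "\<exists>e\<in>leaving E t h X. (col(a := col b)) e = i" using lift1[OF X(1)] by metis
      qed
      moreover have "sees_colours k E h t F2 (col(a := col b))"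
        unfolding sees_colours_def
      proof (intro ballI allI impI)
        fix Y i assume Y: "Y \<in> F2" "i < k"
        then obtain e where "e \<in> leaving (E - {a}) h ?t Y" "col e = i"
          using col(2) unfolding sees_colours_def by blast
        then show "\<exists>e\<in>leaving E h t Y. (col(a := col b)) e = i" using lift2[OF Y(1)] by metis
      qed
      ultimately show ?thesis by blast
    qed
    \<comment> \<open>uncrossing makes the orders of the middle vertices given by out-shores and by in-shores agree\<close>
    have le_iff: "(\<forall>X\<in>F1. m' \<in> X \<longrightarrow> m \<in> X) \<longleftrightarrow> (\<forall>Y\<in>F2. m \<in> Y \<longrightarrow> m' \<in> Y)"
      if mm: "m \<in> ?M" "m' \<in> ?M" for m m'
    proof -
      obtain X0 Y0 where X0: "X0 \<in> F1" "m' \<in> X0" and Y0: "Y0 \<in> F2" "m \<in> Y0" using mm by blast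
      show ?thesis
      proof (intro iffI ballI impI)
        fix Y assume L: "\<forall>X\<in>F1. m' \<in> X \<longrightarrow> m \<in> X" and Y: "Y \<in> F2" "m \<in> Y"
        show "m' \<in> Y"
        proof (rule ccontr)
          assume "m' \<notin> Y"
          then show False using bspec[OF L dicut_systemD(4)[OF sys X0(1) Y(1)]] X0(2) Y(2) by simp
        qed
      next
        fix X assume R: "\<forall>Y\<in>F2. m \<in> Y \<longrightarrow> m' \<in> Y" and X: "X \<in> F1" "m' \<in> X"
        show "m \<in> X"
        proof (rule ccontr)
          assume "m \<notin> X"
          then show False using bspec[OF R dicut_systemD(5)[OF sys X(1) Y0(1)]] Y0(2) X(2) by simp
        qed
      qed
    qed
    show ?thesis
    proof (cases "\<exists>a\<in>E. \<exists>b\<in>E. h a \<in> ?M \<and> t b \<in> ?M \<and> (\<forall>Y\<in>F2. t b \<in> Y \<longrightarrow> h a \<in> Y)")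
      case True
      then obtain a b where ab: "a \<in> E" "b \<in> E" "h a \<in> ?M" "t b \<in> ?M" "\<forall>Y\<in>F2. t b \<in> Y \<longrightarrow> h a \<in> Y"
        by blast
      show ?thesis
      proof (cases "t a \<in> ?M \<or> h b \<in> ?M")
        case True
        then show ?thesis using drop ab by blast
      next
        case False
        then show ?thesis using merge[of a b] ab le_iff[OF ab(4,3)] by blast
      qed
    next
      case False
      \<comment> \<open>only these shores matter now, and no arc has its head or its tail in one of each kind\<close>
      define G1 where "G1 = {X\<in>F1. \<forall>e\<in>E. t e \<in> X \<longrightarrow> t e \<notin> \<Union>F2}"
      define G2 where "G2 = {Y\<in>F2. \<forall>e\<in>E. h e \<in> Y \<longrightarrow> h e \<notin> \<Union>F1}"
      have "\<exists>col. sees_colours k E t h G1 col \<and> sees_colours k E h t G2 col"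
      proof (rule bibranching_colouring[OF fin])
        show "lattice_family G1" unfolding G1_def
          by (rule lattice_family_restrict[OF dicut_systemD(2)[OF sys]]) blast+
        show "lattice_family G2" unfolding G2_def
          by (rule lattice_family_restrict[OF dicut_systemD(3)[OF sys]]) blast+
        show "t e \<in> X" if "X \<in> G1" "e \<in> E" "h e \<in> X" for X e
          using that dicut_systemD(6)[OF sys] by (auto simp: G1_def)
        show "h e \<in> Y" if "Y \<in> G2" "e \<in> E" "t e \<in> Y" for Y e
          using that dicut_systemD(7)[OF sys] by (auto simp: G2_def)
        show "h e \<notin> \<Union>G2" if "e \<in> E" "h e \<in> \<Union>G1" for e using that by (auto simp: G1_def G2_def)
        show "t e \<notin> \<Union>G2" if "e \<in> E" "t e \<in> \<Union>G1" for e using that by (auto simp: G1_def G2_def)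
      qed (use d1 d2 in \<open>auto simp: G1_def G2_def\<close>)
      then obtain col where col: "sees_colours k E t h G1 col" "sees_colours k E h t G2 col"
        by (elim exE conjE)
      have "\<exists>Z\<in>G1. leaving E t h Z \<subseteq> leaving E t h X" if X: "X \<in> F1" for X
      proof -
        have "\<exists>Z\<in>F1. (\<forall>e\<in>E. t e \<in> Z \<longrightarrow> t e \<notin> \<Union>F2) \<and> leaving E t h Z \<subseteq> leaving E t h X"
        proof (rule pure_shores_suffice[OF sys X])
          fix e e' assume e: "e \<in> E" "e' \<in> E" "h e \<in> \<Union>F1" "t e' \<in> \<Union>F1" "t e' \<in> \<Union>F2"
          show "\<exists>Y\<in>F2. t e' \<in> Y \<and> h e \<notin> Y"
          proof (rule ccontr)
            assume "\<not> ?thesis"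
            then have "\<forall>Y\<in>F2. t e' \<in> Y \<longrightarrow> h e \<in> Y" by blast
            moreover from this have "h e \<in> ?M" using e by blast
            ultimately show False using False e by blast
          qed
        qed
        then show ?thesis unfolding G1_def by blast
      qed
      then have "sees_colours k E t h F1 col" by (rule sees_colours_mono[OF col(1)])
      moreover have "\<exists>Z\<in>G2. leaving E h t Z \<subseteq> leaving E h t Y" if Y: "Y \<in> F2" for Y
      proof -
        have "\<exists>Z\<in>F2. (\<forall>e\<in>E. h e \<in> Z \<longrightarrow> h e \<notin> \<Union>F1) \<and> leaving E h t Z \<subseteq> leaving E h t Y"
        proof (rule pure_shores_suffice[OF dicut_system_swap[OF sys] Y])
          fix e e' assume e: "e \<in> E" "e' \<in> E" "t e \<in> \<Union>F2" "h e' \<in> \<Union>F2" "h e' \<in> \<Union>F1"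
          show "\<exists>X\<in>F1. h e' \<in> X \<and> t e \<notin> X"
          proof (rule ccontr)
            assume "\<not> ?thesis"
            then have *: "\<forall>X\<in>F1. h e' \<in> X \<longrightarrow> t e \<in> X" by blast
            moreover from this have "t e \<in> ?M" using e by blast
            moreover have "h e' \<in> ?M" using e by blast
            ultimately have "\<forall>Y\<in>F2. t e \<in> Y \<longrightarrow> h e' \<in> Y" using le_iff by blast
            then show False using False e \<open>t e \<in> ?M\<close> \<open>h e' \<in> ?M\<close> by blast
          qed
        qed
        then show ?thesis unfolding G2_def by blast
      qed
      then have "sees_colours k E h t F2 col" by (rule sees_colours_mono[OF col(2)])
      ultimately show ?thesis by blast
    qed
  qed
qed

section \<open>Ends of digraphs and compactness\<close>

text \<open>
  Tychonoff's theorem for the space of all colourings: that a finite set sees all colours is a closed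
  condition.
\<close>

lemma colouring_compactness:
  fixes \<S> :: "'x set set"
  assumes fin: "\<And>S. S \<in> \<S> \<Longrightarrow> finite S"
    and fip: "\<And>\<T>. finite \<T> \<Longrightarrow> \<T> \<subseteq> \<S> \<Longrightarrow> \<exists>col :: 'x \<Rightarrow> nat. \<forall>S\<in>\<T>. {..<k} \<subseteq> col ` S"
  shows "\<exists>col :: 'x \<Rightarrow> nat. \<forall>S\<in>\<S>. {..<k} \<subseteq> col ` S"
proof (cases "k = 0")
  case False
  define T where "T = product_topology (\<lambda>_ :: 'x. discrete_topology {..<k}) UNIV"
  have top: "topspace T = {f. \<forall>x. f x < k}" by (auto simp: T_def PiE_def Pi_def)
  have comp: "compact_space T"
    unfolding T_def compact_space_product_topology by (simp add: compact_space_discrete_topology)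
  define C where "C S = {f \<in> topspace T. {..<k} \<subseteq> f ` S}" for S
  have closed: "closedin T (C S)" if S: "S \<in> \<S>" for S
  proof -
    have "closedin T {f \<in> topspace T. f x \<in> {i}}" if "i < k" for x i
    proof (rule closedin_continuous_map_preimage)
      show "continuous_map T (discrete_topology {..<k}) (\<lambda>f. f x)"
        unfolding T_def by (rule continuous_map_product_projection) simp
      show "closedin (discrete_topology {..<k}) {i}" using that by simp
    qed
    then have "closedin T (\<Union>x\<in>S. {f \<in> topspace T. f x \<in> {i}})" if "i < k" for i
      using fin[OF S] that by (intro closedin_Union) auto
    then have "closedin T (\<Inter>i\<in>{..<k}. \<Union>x\<in>S. {f \<in> topspace T. f x \<in> {i}})"
      using False by (intro closedin_INT) auto
    also have "(\<Inter>i\<in>{..<k}. \<Union>x\<in>S. {f \<in> topspace T. f x \<in> {i}}) = C S"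
    proof (intro set_eqI iffI)
      fix f assume f: "f \<in> (\<Inter>i\<in>{..<k}. \<Union>x\<in>S. {f \<in> topspace T. f x \<in> {i}})"
      have "0 \<in> {..<k}" using False by simp
      then have "f \<in> topspace T" using f by blast
      moreover have "{..<k} \<subseteq> f ` S" using f by blast
      ultimately show "f \<in> C S" by (simp add: C_def)
    next
      fix f assume "f \<in> C S"
      then show "f \<in> (\<Inter>i\<in>{..<k}. \<Union>x\<in>S. {f \<in> topspace T. f x \<in> {i}})"
        unfolding C_def by blast
    qed
    finally show ?thesis .
  qed
  have inter: "\<Inter>\<F> \<noteq> {}" if \<F>: "finite \<F>" "\<F> \<subseteq> C ` \<S>" for \<F>
  proof -
    obtain \<T> where \<T>: "\<T> \<subseteq> \<S>" "finite \<T>" "\<F> = C ` \<T>" using finite_subset_image[OF \<F>] by blast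
    obtain col :: "'x \<Rightarrow> nat" where col: "\<forall>S\<in>\<T>. {..<k} \<subseteq> col ` S" using fip[OF \<T>(2,1)] by blast
    define f where "f x = (if col x < k then col x else 0)" for x
    have "f \<in> C S" if "S \<in> \<T>" for S
    proof -
      have "{..<k} \<subseteq> f ` S"
      proof
        fix i assume i: "i \<in> {..<k}"
        then obtain x where "x \<in> S" "col x = i" using col \<open>S \<in> \<T>\<close> by blast
        then show "i \<in> f ` S" using i by (intro image_eqI[of _ _ x]) (auto simp: f_def)
      qed
      then show ?thesis using False by (auto simp: C_def top f_def)
    qed
    then show ?thesis using \<T>(3) by blast
  qed
  have "\<Inter>(C ` \<S>) \<noteq> {}"
  proof (rule iffD1[OF compact_space_fip comp, rule_format], intro conjI allI impI ballI)
    show "closedin T K" if "K \<in> C ` \<S>" for K using that closed by blast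
  qed (use inter in blast)
  then show ?thesis unfolding C_def by blast
qed simp

text \<open>
  The two alternatives are a terminal strongly connected component, given by one of its vertices, and an
  out-ray. For the converse relation they become a source component and a back-ray.
\<close>

definition contains_end :: "('v \<times> 'v) set \<Rightarrow> 'v set \<Rightarrow> bool" where
  "contains_end R X \<longleftrightarrow>
     (\<exists>v\<in>X. \<forall>w. (v, w) \<in> R\<^sup>* \<longrightarrow> (w, v) \<in> R\<^sup>* \<and> w \<in> X) \<or>
     (\<exists>r :: nat \<Rightarrow> 'v. inj r \<and> (\<forall>i. (r i, r (Suc i)) \<in> R) \<and> range r \<subseteq> X)"

lemma contains_end_mono: "contains_end R X \<Longrightarrow> X \<subseteq> Y \<Longrightarrow> contains_end R Y"
  unfolding contains_end_def by (meson subset_iff order_trans)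

text \<open>
  If no component in \<open>X\<close> is terminal, every vertex of \<open>X\<close> can leave its component. Walk along arcs that either
  change the component or decrease the distance \<open>dist\<close> to the outside of it. A component once left is never
  entered again and within a component \<open>dist\<close> decreases, so the walk is a ray.
\<close>

lemma closed_contains_end:
  assumes "X \<noteq> {}" and closed: "\<And>v w. v \<in> X \<Longrightarrow> (v, w) \<in> R \<Longrightarrow> w \<in> X"
  shows "contains_end R X"
proof (rule ccontr)
  assume no_end: "\<not> contains_end R X"
  have closed': "w \<in> X" if "(v, w) \<in> R\<^sup>*" "v \<in> X" for v w
    using that by (induction rule: rtrancl_induct) (auto dest: closed)
  define dist where "dist v = (LEAST n. \<exists>w. (v, w) \<in> R ^^ n \<and> (w, v) \<notin> R\<^sup>*)" for v
  have "\<exists>u. (v, u) \<in> R \<and> u \<in> X \<and> ((u, v) \<in> R\<^sup>* \<longrightarrow> dist u < dist v)" if v: "v \<in> X" for v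
  proof -
    obtain w0 where "(v, w0) \<in> R\<^sup>*" "(w0, v) \<notin> R\<^sup>*"
      using no_end v closed' unfolding contains_end_def by blast
    then have "\<exists>n w. (v, w) \<in> R ^^ n \<and> (w, v) \<notin> R\<^sup>*" using rtrancl_imp_relpow by blast
    then obtain w where w: "(v, w) \<in> R ^^ dist v" "(w, v) \<notin> R\<^sup>*"
      unfolding dist_def using LeastI_ex[of "\<lambda>n. \<exists>w. (v, w) \<in> R ^^ n \<and> (w, v) \<notin> R\<^sup>*"] by blast
    have "dist v \<noteq> 0" using w by (metis relpow_0_E rtrancl.rtrancl_refl)
    then obtain m where m: "dist v = Suc m" by (cases "dist v") auto
    then obtain u where u: "(v, u) \<in> R" "(u, w) \<in> R ^^ m" using w(1) by (metis relpow_Suc_D2)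
    have "dist u < dist v" if "(u, v) \<in> R\<^sup>*"
    proof -
      have "(w, u) \<notin> R\<^sup>*" using w(2) that by (meson rtrancl_trans)
      then have "dist u \<le> m" unfolding dist_def by (intro Least_le exI[of _ w]) (use u(2) in blast)
      then show ?thesis using m by simp
    qed
    then show ?thesis using u(1) closed v by blast
  qed
  then obtain nx where nx: "\<And>v. v \<in> X \<Longrightarrow> (v, nx v) \<in> R \<and> nx v \<in> X \<and> ((nx v, v) \<in> R\<^sup>* \<longrightarrow> dist (nx v) < dist v)"
    by metis
  obtain v0 where "v0 \<in> X" using assms(1) by blast
  define r where "r i = (nx ^^ i) v0" for i
  have rX: "r i \<in> X" for i by (induction i) (use \<open>v0 \<in> X\<close> nx in \<open>auto simp: r_def\<close>)
  have step: "(r i, r (Suc i)) \<in> R" "(r (Suc i), r i) \<in> R\<^sup>* \<Longrightarrow> dist (r (Suc i)) < dist (r i)" for i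
    using nx[OF rX[of i]] by (simp_all add: r_def)
  have reach: "(r i, r (i + n)) \<in> R\<^sup>*" for i n
    by (induction n) (use step(1) in \<open>auto intro: rtrancl_into_rtrancl\<close>)
  have ne: "r i \<noteq> r (i + Suc n)" for i n
  proof
    assume eq: "r i = r (i + Suc n)"
    have return: "(r (Suc (i + m)), r (i + m)) \<in> R\<^sup>*" if "m \<le> n" for m
    proof -
      have "(r (Suc (i + m)), r (i + Suc n)) \<in> R\<^sup>*"
        using reach[of "Suc (i + m)" "n - m"] that by simp
      moreover have "(r i, r (i + m)) \<in> R\<^sup>*" by (rule reach)
      ultimately show ?thesis using eq by simp
    qed
    have "dist (r (i + Suc m)) < dist (r i)" if "m \<le> n" for m
      using that
    proof (induction m)
      case 0
      then show ?case using step(2)[of i] return[of 0] by simp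
    next
      case (Suc m)
      then show ?case using step(2)[of "i + Suc m"] return[of "Suc m"] by simp
    qed
    from this[of n] show False using eq by simp
  qed
  have "inj r"
  proof (rule linorder_injI)
    fix i j :: nat assume "i < j"
    then show "r i \<noteq> r j" using ne[of i "j - Suc i"] by simp
  qed
  then have "contains_end R X" using step(1) rX unfolding contains_end_def by blast
  then show False using no_end by blast
qed

text \<open>
  A component that meets a set closed under predecessors is contained in it, and a ray either lies in such
  a set or leaves it forever.
\<close>

lemma contains_end_Un:
  assumes X: "\<And>v w. (v, w) \<in> R \<Longrightarrow> w \<in> X \<Longrightarrow> v \<in> X" and Y: "\<And>v w. (v, w) \<in> R \<Longrightarrow> w \<in> Y \<Longrightarrow> v \<in> Y"
    and "contains_end R (X \<union> Y)"
  shows "contains_end R X \<or> contains_end R Y"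
proof -
  have X': "v \<in> X" if "(v, w) \<in> R\<^sup>*" "w \<in> X" for v w
    using that by (induction rule: converse_rtrancl_induct) (auto dest: X)
  have Y': "v \<in> Y" if "(v, w) \<in> R\<^sup>*" "w \<in> Y" for v w
    using that by (induction rule: converse_rtrancl_induct) (auto dest: Y)
  from assms(3) consider v where "v \<in> X \<union> Y" "\<forall>w. (v, w) \<in> R\<^sup>* \<longrightarrow> (w, v) \<in> R\<^sup>*"
    | r :: "nat \<Rightarrow> 'a" where "inj r" "\<forall>i. (r i, r (Suc i)) \<in> R" "range r \<subseteq> X \<union> Y"
    unfolding contains_end_def by blast
  then show ?thesis
  proof cases
    case 1
    then show ?thesis using X' Y' unfolding contains_end_def by blast
  next
    case (2 r)
    have reach: "(r i, r (i + n)) \<in> R\<^sup>*" for i n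
      by (induction n) (use 2(2) in \<open>auto intro: rtrancl_into_rtrancl\<close>)
    have "range r \<subseteq> X \<or> range r \<subseteq> Y"
    proof (rule disjCI)
      assume "\<not> range r \<subseteq> Y"
      then obtain i where i: "r i \<notin> Y" by blast
      have "r j \<in> X" for j
      proof -
        have "r (i + j) \<notin> Y" using Y'[OF reach] i by blast
        then have "r (i + j) \<in> X" using 2(3) by blast
        moreover have "(r j, r (i + j)) \<in> R\<^sup>*" using reach[of j i] by (simp add: add.commute)
        ultimately show ?thesis using X' by blast
      qed
      then show "range r \<subseteq> X" by blast
    qed
    then show ?thesis using 2 unfolding contains_end_def by blast
  qed
qed

text \<open>
  With \<open>R\<close> the relation given by the arcs these are the out-shores of sink-sided dicuts, with its
  converse the in-shores of source-sided dicuts.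
\<close>

definition endless_shores :: "'v set \<Rightarrow> ('v \<times> 'v) set \<Rightarrow> 'v set set" where
  "endless_shores V R = {X. X \<subseteq> V \<and> X \<noteq> {} \<and> (\<forall>v w. (v, w) \<in> R \<longrightarrow> w \<in> X \<longrightarrow> v \<in> X) \<and> \<not> contains_end R X}"

lemma endless_Un: "X \<in> endless_shores V R \<Longrightarrow> Y \<in> endless_shores V R \<Longrightarrow> X \<union> Y \<in> endless_shores V R"
  using contains_end_Un[of R X Y] by (auto simp: endless_shores_def)

lemma endless_Int:
  "X \<in> endless_shores V R \<Longrightarrow> Y \<in> endless_shores V R \<Longrightarrow> X \<inter> Y \<noteq> {} \<Longrightarrow> X \<inter> Y \<in> endless_shores V R"
  using contains_end_mono[of R "X \<inter> Y" X] by (auto simp: endless_shores_def)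

text \<open>
  The point is that \<open>X - Y\<close> is not empty: \<open>X\<close> is closed under predecessors and so contains an end of
  the converse relation, whereas \<open>Y\<close> contains none.
\<close>

lemma endless_Diff:
  assumes X: "X \<in> endless_shores V R" and Y: "Y \<in> endless_shores V (converse R)"
  shows "X - Y \<in> endless_shores V R"
proof -
  have "X - Y \<noteq> {}"
  proof
    assume "X - Y = {}"
    have "contains_end (converse R) X"
      by (rule closed_contains_end) (use X in \<open>auto simp: endless_shores_def\<close>)
    then have "contains_end (converse R) Y" by (rule contains_end_mono) (use \<open>X - Y = {}\<close> in blast)
    then show False using Y by (simp add: endless_shores_def)
  qed
  then show ?thesis using X Y contains_end_mono[of R "X - Y" X]
    by (auto simp: endless_shores_def)
qed

lemma endless_not_all:
  assumes "X \<in> endless_shores V R" and "R \<subseteq> V \<times> V"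
  shows "X \<noteq> V"
proof
  assume "X = V"
  have "contains_end R V" by (rule closed_contains_end) (use assms \<open>X = V\<close> in \<open>auto simp: endless_shores_def\<close>)
  then show False using assms(1) \<open>X = V\<close> by (simp add: endless_shores_def)
qed

lemma leaving_Un_subset: "leaving P t h (X \<union> Y) \<subseteq> leaving P t h X \<union> leaving P t h Y"
  and leaving_Int_subset: "leaving P t h (X \<inter> Y) \<subseteq> leaving P t h X \<union> leaving P t h Y"
  and leaving_Diff_subset: "leaving P t h (X - Y) \<subseteq> leaving P t h X \<union> leaving P h t Y"
  by (auto simp: leaving_def)

lemma sees_colours_iff: "sees_colours k E t h F col \<longleftrightarrow> (\<forall>X\<in>F. {..<k} \<subseteq> col ` leaving E t h X)"
  unfolding sees_colours_def by (rule ball_cong[OF refl]) blast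

text \<open>
  By compactness only finitely many shores have to be served at a time. The members of \<open>H1\<close> and \<open>H2\<close>
  in the finite Boolean algebra generated by them form a dicut system: uncrossing stays inside the algebra, and
  it keeps cuts finite because each new cut is contained in the union of the two old ones.
\<close>

theorem source_sink_colouring:
  fixes P :: "'x set" and t h :: "'x \<Rightarrow> 'v" and V :: "'v set" and R :: "('v \<times> 'v) set"
  defines "H1 \<equiv> {X \<in> endless_shores V R. finite (leaving P t h X)}"
    and "H2 \<equiv> {Y \<in> endless_shores V (converse R). finite (leaving P h t Y)}"
  assumes P: "\<And>x. x \<in> P \<Longrightarrow> (t x, h x) \<in> R"
    and k1: "\<And>X. X \<in> H1 \<Longrightarrow> k \<le> card (leaving P t h X)"
    and k2: "\<And>Y. Y \<in> H2 \<Longrightarrow> k \<le> card (leaving P h t Y)"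
  shows "dijoin_colourable k P t h H1 H2"
proof -
  define \<S> where "\<S> = leaving P t h ` H1 \<union> leaving P h t ` H2"
  have lat: "X \<union> Y \<in> H \<and> (X \<inter> Y \<noteq> {} \<longrightarrow> X \<inter> Y \<in> H)"
    if "H = {X \<in> endless_shores V Q. finite (leaving P s s' X)}" "X \<in> H" "Y \<in> H" for H Q s s' X Y
    using that by (auto intro: endless_Un endless_Int finite_subset[OF leaving_Un_subset]
        finite_subset[OF leaving_Int_subset])
  have diff: "X - Y \<in> H1 \<and> Y - X \<in> H2" if "X \<in> H1" "Y \<in> H2" for X Y
  proof -
    have "finite (leaving P t h (X - Y))" "finite (leaving P h t (Y - X))"
      using that by (simp_all add: H1_def H2_def finite_subset[OF leaving_Diff_subset])
    then show ?thesis using that endless_Diff[of X V R Y] endless_Diff[of Y V "converse R" X]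
      by (simp add: H1_def H2_def)
  qed
  have "\<exists>col :: 'x \<Rightarrow> nat. \<forall>S\<in>\<S>. {..<k} \<subseteq> col ` S"
  proof (rule colouring_compactness)
    show "finite S" if "S \<in> \<S>" for S using that by (auto simp: \<S>_def H1_def H2_def)
  next
    fix \<T> assume \<T>: "finite \<T>" "\<T> \<subseteq> \<S>"
    have fins: "finite (\<T> \<inter> leaving P t h ` H1)" "finite (\<T> \<inter> leaving P h t ` H2)"
      using \<T>(1) by auto
    obtain G1 where G1: "G1 \<subseteq> H1" "finite G1" "\<T> \<inter> leaving P t h ` H1 = leaving P t h ` G1"
      using finite_subset_image[OF fins(1) inf_le2] by blast
    obtain G2 where G2: "G2 \<subseteq> H2" "finite G2" "\<T> \<inter> leaving P h t ` H2 = leaving P h t ` G2"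
      using finite_subset_image[OF fins(2) inf_le2] by blast
    \<comment> \<open>the finite Boolean algebra of sets generated by the chosen shores\<close>
    define atom where "atom v = {Z \<in> G1 \<union> G2. v \<in> Z}" for v
    define Alg where "Alg = (\<lambda>T. atom -` T) ` Pow (Pow (G1 \<union> G2))"
    have finAlg: "finite Alg" unfolding Alg_def using G1(2) G2(2) by simp
    have algI: "Z \<in> Alg" if "T \<subseteq> Pow (G1 \<union> G2)" "Z = atom -` T" for Z T
      using that by (auto simp: Alg_def)
    have alg: "X \<union> Y \<in> Alg" "X \<inter> Y \<in> Alg" "X - Y \<in> Alg" if XY: "X \<in> Alg" "Y \<in> Alg" for X Y
    proof -
      obtain S T where S: "S \<subseteq> Pow (G1 \<union> G2)" "X = atom -` S" and T: "T \<subseteq> Pow (G1 \<union> G2)" "Y = atom -` T"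
        using XY by (auto simp: Alg_def)
      show "X \<union> Y \<in> Alg" by (rule algI[of "S \<union> T"]) (use S T in auto)
      show "X \<inter> Y \<in> Alg" by (rule algI[of "S \<inter> T"]) (use S T in auto)
      show "X - Y \<in> Alg" by (rule algI[of "S - T"]) (use S T in auto)
    qed
    have gen: "Z \<in> Alg" if "Z \<in> G1 \<union> G2" for Z
      by (rule algI[of "{S. S \<subseteq> G1 \<union> G2 \<and> Z \<in> S}"]) (use that in \<open>auto simp: atom_def\<close>)
    define F1 where "F1 = H1 \<inter> Alg"
    define F2 where "F2 = H2 \<inter> Alg"
    define E where "E = \<Union>(leaving P t h ` F1) \<union> \<Union>(leaving P h t ` F2)"
    have "finite E" unfolding E_def F1_def F2_def using finAlg by (auto simp: H1_def H2_def)
    have EP: "E \<subseteq> P" by (auto simp: E_def leaving_def)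
    have l1: "leaving E t h X = leaving P t h X" if "X \<in> F1" for X
      using that EP unfolding E_def leaving_def by blast
    have l2: "leaving E h t Y = leaving P h t Y" if "Y \<in> F2" for Y
      using that EP unfolding E_def leaving_def by blast
    have "lattice_family F1" "lattice_family F2"
      unfolding lattice_family_def using finAlg lat[OF H1_def[THEN meta_eq_to_obj_eq]]
        lat[OF H2_def[THEN meta_eq_to_obj_eq]] alg
      by (auto simp: F1_def F2_def H1_def H2_def endless_shores_def)
    moreover have "\<forall>X\<in>F1. \<forall>Y\<in>F2. X - Y \<in> F1 \<and> Y - X \<in> F2"
      using diff alg(3) by (auto simp: F1_def F2_def)
    moreover have "\<forall>X\<in>F1. \<forall>e\<in>E. h e \<in> X \<longrightarrow> t e \<in> X" "\<forall>Y\<in>F2. \<forall>e\<in>E. t e \<in> Y \<longrightarrow> h e \<in> Y"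
      using P EP unfolding F1_def F2_def H1_def H2_def endless_shores_def by blast+
    ultimately have "dicut_system E t h F1 F2" using \<open>finite E\<close> by (simp add: dicut_system_def)
    then have "dijoin_colourable k E t h F1 F2"
    proof (rule finite_source_sink_colouring)
      show "k \<le> card (leaving E t h X)" if "X \<in> F1" for X
        using k1[of X] that unfolding l1[OF that] by (simp add: F1_def)
      show "k \<le> card (leaving E h t Y)" if "Y \<in> F2" for Y
        using k2[of Y] that unfolding l2[OF that] by (simp add: F2_def)
    qed
    then obtain col where col: "sees_colours k E t h F1 col" "sees_colours k E h t F2 col" by (elim exE conjE)
    have "{..<k} \<subseteq> col ` S" if S: "S \<in> \<T>" for S
    proof -
      have "S \<in> \<T> \<inter> leaving P t h ` H1 \<or> S \<in> \<T> \<inter> leaving P h t ` H2"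
        using subsetD[OF \<T>(2) S] S by (simp only: \<S>_def Un_iff Int_iff simp_thms)
      then have "S \<in> leaving P t h ` G1 \<or> S \<in> leaving P h t ` G2" by (simp only: G1(3) G2(3))
      then show ?thesis
      proof
        assume "S \<in> leaving P t h ` G1"
        then obtain X where X: "X \<in> G1" "S = leaving P t h X" by blast
        then have "X \<in> F1" using G1(1) gen by (auto simp: F1_def)
        then show ?thesis using col(1) X(2) l1 by (simp add: sees_colours_iff)
      next
        assume "S \<in> leaving P h t ` G2"
        then obtain X where X: "X \<in> G2" "S = leaving P h t X" by blast
        then have "X \<in> F2" using G2(1) gen by (auto simp: F2_def)
        then show ?thesis using col(2) X(2) l2 by (simp add: sees_colours_iff)
      qed
    qed
    then show "\<exists>col :: 'x \<Rightarrow> nat. \<forall>S\<in>\<T>. {..<k} \<subseteq> col ` S" by blast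
  qed
  then obtain col :: "'x \<Rightarrow> nat" where col: "\<forall>S\<in>\<S>. {..<k} \<subseteq> col ` S" by blast
  have "sees_colours k P t h H1 col" "sees_colours k P h t H2 col"
    using col by (simp_all add: sees_colours_iff \<S>_def)
  then show ?thesis by blast
qed

section \<open>Source-sink dicuts\<close>

lemma sink_component_iff:
  assumes "wf_digraph D" and X: "X \<subseteq> verts D"
  shows "(\<exists>C. sink_component D C \<and> verts C \<subseteq> X) \<longleftrightarrow>
    (\<exists>v\<in>X. \<forall>w. (v, w) \<in> (arcs_ends D)\<^sup>* \<longrightarrow> (w, v) \<in> (arcs_ends D)\<^sup>* \<and> w \<in> X)"
proof -
  interpret wf_digraph D by fact
  show ?thesis
  proof
    assume "\<exists>C. sink_component D C \<and> verts C \<subseteq> X"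
    then obtain C where C: "C \<in> sccs" "verts C \<subseteq> X"
      and closed: "\<And>e. e \<in> arcs D \<Longrightarrow> tail D e \<in> verts C \<Longrightarrow> head D e \<in> verts C"
      unfolding sink_component_def by blast
    have S: "verts C \<in> sccs_verts" using C(1) by (intro in_sccs_vertsI_sccs imageI)
    then obtain v where v: "v \<in> verts C" by (auto simp: in_sccs_verts_conv_reachable)
    have "w \<in> verts C" if "(v, w) \<in> (arcs_ends D)\<^sup>*" for w
      using that
    proof (induction rule: rtrancl_induct)
      case (step y z)
      then show ?case using closed by (auto simp: arcs_ends_conv)
    qed (rule v)
    moreover have "(w, v) \<in> (arcs_ends D)\<^sup>*" if "w \<in> verts C" for w
      using S v that by (auto simp: in_sccs_verts_conv_reachable reachable_conv)
    ultimately show "\<exists>v\<in>X. \<forall>w. (v, w) \<in> (arcs_ends D)\<^sup>* \<longrightarrow> (w, v) \<in> (arcs_ends D)\<^sup>* \<and> w \<in> X"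
      using v C(2) by blast
  next
    assume "\<exists>v\<in>X. \<forall>w. (v, w) \<in> (arcs_ends D)\<^sup>* \<longrightarrow> (w, v) \<in> (arcs_ends D)\<^sup>* \<and> w \<in> X"
    then obtain v where v: "v \<in> X"
      and returns: "\<And>w. (v, w) \<in> (arcs_ends D)\<^sup>* \<Longrightarrow> (w, v) \<in> (arcs_ends D)\<^sup>* \<and> w \<in> X" by blast
    have vD: "v \<in> verts D" using v X by blast
    have scc: "scc_of v = {w. (v, w) \<in> (arcs_ends D)\<^sup>*}"
      using returns X vD by (auto simp: scc_of_def reachable_conv)
    have "D \<restriction> scc_of v \<in> sccs"
      using scc_of_in_sccs_verts[OF vD] by (simp only: in_sccs_verts_conv)
    moreover have "head D e \<in> scc_of v" if "e \<in> arcs D" "tail D e \<in> scc_of v" for e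
    proof -
      have "(tail D e, head D e) \<in> arcs_ends D" using that(1) by (auto simp: arcs_ends_conv)
      then show ?thesis using that(2) unfolding scc by (auto intro: rtrancl_into_rtrancl)
    qed
    ultimately have "sink_component D (D \<restriction> scc_of v)" by (auto simp: sink_component_def)
    moreover have "verts (D \<restriction> scc_of v) \<subseteq> X" using returns by (auto simp: scc)
    ultimately show "\<exists>C. sink_component D C \<and> verts C \<subseteq> X" by blast
  qed
qed

lemma source_component_iff:
  assumes "wf_digraph D" and X: "X \<subseteq> verts D"
  shows "(\<exists>C. source_component D C \<and> verts C \<subseteq> X) \<longleftrightarrow>
    (\<exists>v\<in>X. \<forall>w. (w, v) \<in> (arcs_ends D)\<^sup>* \<longrightarrow> (v, w) \<in> (arcs_ends D)\<^sup>* \<and> w \<in> X)"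
proof -
  interpret wf_digraph D by fact
  show ?thesis
  proof
    assume "\<exists>C. source_component D C \<and> verts C \<subseteq> X"
    then obtain C where C: "C \<in> sccs" "verts C \<subseteq> X"
      and closed: "\<And>e. e \<in> arcs D \<Longrightarrow> head D e \<in> verts C \<Longrightarrow> tail D e \<in> verts C"
      unfolding source_component_def by blast
    have S: "verts C \<in> sccs_verts" using C(1) by (intro in_sccs_vertsI_sccs imageI)
    then obtain v where v: "v \<in> verts C" by (auto simp: in_sccs_verts_conv_reachable)
    have "w \<in> verts C" if "(w, v) \<in> (arcs_ends D)\<^sup>*" for w
      using that
    proof (induction rule: converse_rtrancl_induct)
      case (step y z)
      then show ?case using closed by (auto simp: arcs_ends_conv)
    qed (rule v)
    moreover have "(v, w) \<in> (arcs_ends D)\<^sup>*" if "w \<in> verts C" for w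
      using S v that by (auto simp: in_sccs_verts_conv_reachable reachable_conv)
    ultimately show "\<exists>v\<in>X. \<forall>w. (w, v) \<in> (arcs_ends D)\<^sup>* \<longrightarrow> (v, w) \<in> (arcs_ends D)\<^sup>* \<and> w \<in> X"
      using v C(2) by blast
  next
    assume "\<exists>v\<in>X. \<forall>w. (w, v) \<in> (arcs_ends D)\<^sup>* \<longrightarrow> (v, w) \<in> (arcs_ends D)\<^sup>* \<and> w \<in> X"
    then obtain v where v: "v \<in> X"
      and forth: "\<And>w. (w, v) \<in> (arcs_ends D)\<^sup>* \<Longrightarrow> (v, w) \<in> (arcs_ends D)\<^sup>* \<and> w \<in> X" by blast
    have vD: "v \<in> verts D" using v X by blast
    have scc: "scc_of v = {w. (w, v) \<in> (arcs_ends D)\<^sup>*}"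
      using forth X vD by (auto simp: scc_of_def reachable_conv)
    have "D \<restriction> scc_of v \<in> sccs"
      using scc_of_in_sccs_verts[OF vD] by (simp only: in_sccs_verts_conv)
    moreover have "tail D e \<in> scc_of v" if "e \<in> arcs D" "head D e \<in> scc_of v" for e
    proof -
      have "(tail D e, head D e) \<in> arcs_ends D" using that(1) by (auto simp: arcs_ends_conv)
      then show ?thesis using that(2) unfolding scc by (auto intro: converse_rtrancl_into_rtrancl)
    qed
    ultimately have "source_component D (D \<restriction> scc_of v)" by (auto simp: source_component_def)
    moreover have "verts (D \<restriction> scc_of v) \<subseteq> X" using forth by (auto simp: scc)
    ultimately show "\<exists>C. source_component D C \<and> verts C \<subseteq> X" by blast
  qed
qed

lemma sink_sided_iff:
  assumes "wf_digraph D" and "out_shore D B \<subseteq> verts D"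
  shows "sink_sided D B \<longleftrightarrow> \<not> contains_end (arcs_ends D) (out_shore D B)"
  unfolding sink_sided_def contains_end_def sink_component_iff[OF assms] out_ray_def by blast

lemma source_sided_iff:
  assumes "wf_digraph D" and "in_shore D B \<subseteq> verts D"
  shows "source_sided D B \<longleftrightarrow> \<not> contains_end (converse (arcs_ends D)) (in_shore D B)"
  unfolding source_sided_def contains_end_def source_component_iff[OF assms] back_ray_def
  by (simp add: rtrancl_converse conj_assoc)

lemma dicut_obtain_shores:
  assumes "connected D" and "dicut D B"
  obtains X Y where "bipartition D X Y" "B = edges_between D X Y" "\<forall>e\<in>B. head D e \<in> Y"
    "out_shore D B = X" "in_shore D B = Y"
proof -
  obtain X Y where XY: "bipartition D X Y" "B = edges_between D X Y" "\<forall>e\<in>B. head D e \<in> Y"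
    using assms(2) unfolding dicut_def by (metis bipartition_commute edges_between_commute)
  show thesis by (rule that[OF XY]) (use dicut_shores[OF assms(1) XY] in simp_all)
qed

lemma dicut_subset_arcs: "dicut D B \<Longrightarrow> B \<subseteq> arcs D"
  by (auto simp: dicut_def edges_between_def)

lemma copies_in_cut:
  assumes "bipartition D X Y" and "\<forall>e\<in>edges_between D X Y. head D e \<in> Y" and "a ` P \<subseteq> arcs D" and "wf_digraph D"
  shows "{x \<in> P. a x \<in> edges_between D X Y} = leaving P (tail D \<circ> a) (head D \<circ> a) X"
    and "{x \<in> P. a x \<in> edges_between D X Y} = leaving P (head D \<circ> a) (tail D \<circ> a) Y"
proof -
  interpret wf_digraph D by fact
  have side: "v \<in> X \<longleftrightarrow> v \<notin> Y" if "v \<in> verts D" for v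
    using assms(1) that by (auto simp: bipartition_def)
  have ends: "a x \<in> arcs D" "tail D (a x) \<in> verts D" "head D (a x) \<in> verts D" if "x \<in> P" for x
    using assms(3) that by auto
  have "a x \<in> edges_between D X Y \<longleftrightarrow> tail D (a x) \<in> X \<and> head D (a x) \<notin> X" if "x \<in> P" for x
    using assms(2) ends[OF that] side by (auto simp: edges_between_def)
  then show "{x \<in> P. a x \<in> edges_between D X Y} = leaving P (tail D \<circ> a) (head D \<circ> a) X"
    by (auto simp: leaving_def)
  also have "\<dots> = leaving P (head D \<circ> a) (tail D \<circ> a) Y"
    using ends side by (auto simp: leaving_def)
  finally show "{x \<in> P. a x \<in> edges_between D X Y} = leaving P (head D \<circ> a) (tail D \<circ> a) Y" .
qed

text \<open>
  Closure of \<open>X\<close> under predecessors turns every cut with side \<open>X\<close> into a dicut, which provides the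
  converse passage from shores to dicuts.
\<close>

lemma dicut_of_closed_shore:
  assumes "wf_digraph D" "connected D" and bp: "bipartition D X Y"
    and closed: "\<And>v w. (v, w) \<in> arcs_ends D \<Longrightarrow> w \<in> X \<Longrightarrow> v \<in> X"
  defines "B \<equiv> edges_between D X Y"
  shows "\<forall>e\<in>B. head D e \<in> Y" "dicut D B" "out_shore D B = X" "in_shore D B = Y"
proof -
  have disj: "X \<inter> Y = {}" using bp by (simp add: bipartition_def)
  have "head D e \<in> Y" if "e \<in> B" for e
  proof -
    have e: "e \<in> arcs D" "tail D e \<in> X \<and> head D e \<in> Y \<or> tail D e \<in> Y \<and> head D e \<in> X"
      using that by (auto simp: B_def edges_between_def)
    have "(tail D e, head D e) \<in> arcs_ends D" using e(1) by (auto simp: arcs_ends_conv)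
    then show ?thesis using e(2) closed disj by blast
  qed
  then show heads: "\<forall>e\<in>B. head D e \<in> Y" by blast
  show "dicut D B" unfolding dicut_def using bp heads B_def by blast
  show "out_shore D B = X" "in_shore D B = Y"
    using dicut_shores[OF assms(2) bp _ heads] by (simp_all add: B_def)
qed

text \<open>
  \<open>P\<close> is a set of copies of arcs, \<open>a\<close> maps a copy to its arc. The identity yields sizes, and the set of pairs
  of an arc with an element of the field of its capacity yields capacities.
\<close>

lemma source_sink_dicut_colouring:
  fixes D :: "('v, 'e) pre_digraph" and a :: "'x \<Rightarrow> 'e"
  assumes wf: "wf_digraph D" and con: "connected D" and P: "a ` P \<subseteq> arcs D"
    and k: "\<And>B. source_sink_dicut D B \<Longrightarrow> finite {x \<in> P. a x \<in> B} \<Longrightarrow> k \<le> card {x \<in> P. a x \<in> B}"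
  shows "\<exists>col :: 'x \<Rightarrow> nat. \<forall>B. source_sink_dicut D B \<and> finite {x \<in> P. a x \<in> B} \<longrightarrow>
    {..<k} \<subseteq> col ` {x \<in> P. a x \<in> B}"
proof -
  interpret wf_digraph D by fact
  let ?t = "tail D \<circ> a" and ?h = "head D \<circ> a" and ?R = "arcs_ends D" and ?V = "verts D"
  have RV: "?R \<subseteq> ?V \<times> ?V" by (auto simp: arcs_ends_conv)
  have "dijoin_colourable k P ?t ?h {X \<in> endless_shores ?V ?R. finite (leaving P ?t ?h X)}
      {Y \<in> endless_shores ?V (converse ?R). finite (leaving P ?h ?t Y)}"
  proof (rule source_sink_colouring)
    show "(?t x, ?h x) \<in> ?R" if "x \<in> P" for x using that P by (auto simp: arcs_ends_conv)
  next
    fix X assume "X \<in> {X \<in> endless_shores ?V ?R. finite (leaving P ?t ?h X)}"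
    then have X: "X \<in> endless_shores ?V ?R" and fin: "finite (leaving P ?t ?h X)" by simp_all
    have bp: "bipartition D X (?V - X)" using X endless_not_all[OF X RV]
      by (auto simp: bipartition_def endless_shores_def)
    define B where "B = edges_between D X (?V - X)"
    have B: "\<forall>e\<in>B. head D e \<in> ?V - X" "dicut D B" "out_shore D B = X" "in_shore D B = ?V - X"
      unfolding B_def
      by (rule dicut_of_closed_shore[OF wf con bp]; use X in \<open>auto simp: endless_shores_def\<close>)+
    have "sink_sided D B" using X B(3) by (subst sink_sided_iff[OF wf]) (auto simp: endless_shores_def)
    then have "source_sink_dicut D B" using B(2) by (simp add: source_sink_dicut_def)
    moreover have "{x \<in> P. a x \<in> B} = leaving P ?t ?h X"
      unfolding B_def by (rule copies_in_cut(1)[OF bp _ P wf]) (use B(1) in \<open>simp add: B_def\<close>)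
    ultimately show "k \<le> card (leaving P ?t ?h X)" using k fin by metis
  next
    fix Y assume "Y \<in> {Y \<in> endless_shores ?V (converse ?R). finite (leaving P ?h ?t Y)}"
    then have Y: "Y \<in> endless_shores ?V (converse ?R)" and fin: "finite (leaving P ?h ?t Y)" by simp_all
    have "converse ?R \<subseteq> ?V \<times> ?V" using RV by blast
    then have bp: "bipartition D (?V - Y) Y" using Y endless_not_all[OF Y]
      by (auto simp: bipartition_def endless_shores_def)
    define B where "B = edges_between D (?V - Y) Y"
    have closed: "v \<in> ?V - Y" if "(v, w) \<in> ?R" "w \<in> ?V - Y" for v w
      using that Y RV by (auto simp: endless_shores_def)
    have B: "\<forall>e\<in>B. head D e \<in> Y" "dicut D B" "out_shore D B = ?V - Y" "in_shore D B = Y"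
      unfolding B_def by (rule dicut_of_closed_shore[OF wf con bp closed]; assumption)+
    have "source_sided D B" using Y B(4) by (subst source_sided_iff[OF wf]) (auto simp: endless_shores_def)
    then have "source_sink_dicut D B" using B(2) by (simp add: source_sink_dicut_def)
    moreover have "{x \<in> P. a x \<in> B} = leaving P ?h ?t Y"
      unfolding B_def by (rule copies_in_cut(2)[OF bp _ P wf]) (use B(1) in \<open>simp add: B_def\<close>)
    ultimately show "k \<le> card (leaving P ?h ?t Y)" using k fin by metis
  qed
  then obtain col where
    col1: "sees_colours k P ?t ?h {X \<in> endless_shores ?V ?R. finite (leaving P ?t ?h X)} col" and
    col2: "sees_colours k P ?h ?t {Y \<in> endless_shores ?V (converse ?R). finite (leaving P ?h ?t Y)} col"
    by (elim exE conjE)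
  have "{..<k} \<subseteq> col ` {x \<in> P. a x \<in> B}"
    if B: "source_sink_dicut D B" and fin: "finite {x \<in> P. a x \<in> B}" for B
  proof -
    have "dicut D B" using B by (simp add: source_sink_dicut_def)
    then obtain X Y where bp: "bipartition D X Y" and Beq: "B = edges_between D X Y"
      and heads: "\<forall>e\<in>B. head D e \<in> Y" and shores: "out_shore D B = X" "in_shore D B = Y"
      by (rule dicut_obtain_shores[OF con])
    have sub: "X \<subseteq> ?V" "Y \<subseteq> ?V" "X \<noteq> {}" "Y \<noteq> {}" "X \<inter> Y = {}" "X \<union> Y = ?V"
      using bp by (auto simp: bipartition_def)
    have closed: "v \<in> X" if vw: "(v, w) \<in> ?R" "w \<in> X" for v w
    proof (rule ccontr)
      assume "v \<notin> X"
      obtain e where e: "e \<in> arcs D" "tail D e = v" "head D e = w"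
        using vw(1) by (auto simp: arcs_ends_conv)
      then have "v \<in> Y" using \<open>v \<notin> X\<close> sub(6) tail_in_verts by blast
      then have "e \<in> B" using e vw(2) by (simp add: Beq edges_between_def)
      then show False using heads e(3) vw(2) sub(5) by blast
    qed
    have "sink_sided D B \<or> source_sided D B" using B by (auto simp: source_sink_dicut_def)
    then show ?thesis
    proof
      assume "sink_sided D B"
      then have "\<not> contains_end ?R X" using sink_sided_iff[OF wf, of B] shores sub by simp
      then have "X \<in> endless_shores ?V ?R" using sub closed unfolding endless_shores_def by blast
      moreover have "{x \<in> P. a x \<in> B} = leaving P ?t ?h X"
        unfolding Beq by (rule copies_in_cut(1)[OF bp _ P wf]) (use heads Beq in simp)
      ultimately show ?thesis using col1 fin by (simp add: sees_colours_iff)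
    next
      assume "source_sided D B"
      then have end_free: "\<not> contains_end (converse ?R) Y" using source_sided_iff[OF wf, of B] shores sub by simp
      have "w \<in> Y" if "(v, w) \<in> ?R" "v \<in> Y" for v w
      proof -
        have "w \<in> ?V" using that(1) RV by blast
        then show ?thesis using closed[OF that(1)] that(2) sub(5,6) by blast
      qed
      then have "Y \<in> endless_shores ?V (converse ?R)" using sub end_free unfolding endless_shores_def by blast
      moreover have "{x \<in> P. a x \<in> B} = leaving P ?h ?t Y"
        unfolding Beq by (rule copies_in_cut(2)[OF bp _ P wf]) (use heads Beq in simp)
      ultimately show ?thesis using col2 fin by (simp add: sees_colours_iff)
    qed
  qed
  then show ?thesis by blast
qed

lemma card_of_le_finite: "finite A \<Longrightarrow> finite B \<Longrightarrow> card A \<le> card B \<Longrightarrow> |A| \<le>o |B|"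
  using card_le_inj[of A B] card_of_ordLeq[of A B] by blast

lemma card_of_eq_finite: "finite A \<Longrightarrow> finite B \<Longrightarrow> card A = card B \<Longrightarrow> |A| =o |B|"
  using finite_same_card_bij[of A B] card_of_ordIso[of A B] by blast

lemma woodall_source_sink:
  fixes D :: "('v, 'e) pre_digraph"
  assumes wf: "wf_digraph D" and con: "connected D"
    and ne: "{B. source_sink_dicut D B \<and> finite B} \<noteq> {}"
  shows "woodall D {B. source_sink_dicut D B \<and> finite B}"
proof -
  let ?\<BB> = "{B. source_sink_dicut D B \<and> finite B}"
  have "\<exists>B. B \<in> ?\<BB>" using ne by blast
  then obtain B where B: "B \<in> ?\<BB>" and min: "\<And>B'. B' \<in> ?\<BB> \<Longrightarrow> card B \<le> card B'"
    using ex_has_least_nat[of "\<lambda>B. B \<in> ?\<BB>" _ card] by blast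
  have arcs: "B' \<subseteq> arcs D" if "source_sink_dicut D B'" for B'
    using that dicut_subset_arcs by (auto simp: source_sink_dicut_def)
  have copies: "{x \<in> arcs D. id x \<in> B'} = B'" if "source_sink_dicut D B'" for B' using arcs[OF that] by auto
  have "\<exists>col :: 'e \<Rightarrow> nat. \<forall>B'. source_sink_dicut D B' \<and> finite {x \<in> arcs D. id x \<in> B'} \<longrightarrow>
      {..<card B} \<subseteq> col ` {x \<in> arcs D. id x \<in> B'}"
    by (rule source_sink_dicut_colouring[OF wf con]) (use min copies in auto)
  then obtain col :: "'e \<Rightarrow> nat" where sees:
    "\<forall>B'. source_sink_dicut D B' \<and> finite {x \<in> arcs D. id x \<in> B'} \<longrightarrow>
      {..<card B} \<subseteq> col ` {x \<in> arcs D. id x \<in> B'}" by (elim exE)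
  have col: "{..<card B} \<subseteq> col ` B'" if "B' \<in> ?\<BB>" for B'
    using spec[OF sees, of B'] that copies[of B'] by simp
  define F where "F i = {e \<in> arcs D. col e = i}" for i
  define \<FF> where "\<FF> = F ` {..<card B}"
  have meets: "F i \<inter> B' \<noteq> {}" if i: "i < card B" and B': "B' \<in> ?\<BB>" for i B'
  proof -
    obtain e where "e \<in> B'" "col e = i" using col[OF B'] i by blast
    then show ?thesis using arcs[of B'] B' by (auto simp: F_def)
  qed
  have "inj_on F {..<card B}"
  proof (rule inj_onI)
    fix i j assume ij: "i \<in> {..<card B}" "F i = F j"
    then obtain e where "e \<in> F i" using meets[OF _ B, of i] by blast
    then have "col e = i" "col e = j" using ij(2) by (auto simp: F_def)
    then show "i = j" by simp
  qed
  then have "card \<FF> = card B" "finite \<FF>" by (simp_all add: \<FF>_def card_image)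
  then have iso: "|B| =o |\<FF>|" using B by (intro card_of_eq_finite) auto
  have "disjoint_dijoins D ?\<BB> \<FF>"
    unfolding disjoint_dijoins_def
  proof
    show "\<forall>G\<in>\<FF>. dijoin D ?\<BB> G" using meets by (auto simp: \<FF>_def dijoin_def F_def)
    show "pairwise disjnt \<FF>" by (auto simp: \<FF>_def pairwise_def disjnt_def F_def)
  qed
  moreover have "|\<FF>'| \<le>o |\<FF>|" if \<FF>': "disjoint_dijoins D ?\<BB> \<FF>'" for \<FF>'
  proof -
    have "\<exists>e. e \<in> G \<inter> B" if "G \<in> \<FF>'" for G
      using \<FF>' B that unfolding disjoint_dijoins_def dijoin_def by blast
    then obtain p where p: "\<And>G. G \<in> \<FF>' \<Longrightarrow> p G \<in> G \<inter> B" by metis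
    have "inj_on p \<FF>'"
    proof (rule inj_onI, rule ccontr)
      fix G H assume GH: "G \<in> \<FF>'" "H \<in> \<FF>'" "p G = p H" "G \<noteq> H"
      then have "disjnt G H" using \<FF>' by (auto simp: disjoint_dijoins_def pairwise_def)
      then show False using p[OF GH(1)] p[OF GH(2)] GH(3) by (auto simp: disjnt_def)
    qed
    moreover have "p ` \<FF>' \<subseteq> B" using p by blast
    ultimately have "|\<FF>'| \<le>o |B|" using card_of_ordLeq[of \<FF>' B] by blast
    then show ?thesis using iso by (rule ordLeq_ordIso_trans)
  qed
  moreover have "|B| \<le>o |B'|" if "B' \<in> ?\<BB>" for B'
    using B that min by (intro card_of_le_finite) auto
  ultimately show ?thesis unfolding woodall_def using B iso by blast
qed

lemma cap_eq_card_of: "cap c A = |SIGMA e : A. Field (c e)|"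
  by (simp add: cap_def Csum_def Field_card_of)

text \<open>
  The elements of the field of \<open>c e\<close> serve as copies of the arc \<open>e\<close>. The dijoins are indexed by the
  copies of the arcs of a dicut of least capacity, so that the size of the family is this capacity. An arc lies in no more
  dijoins than it has copies, since each of them uses a copy of its own colour.
\<close>

lemma woodall_wrt_source_sink:
  fixes D :: "('v, 'e) pre_digraph" and c :: "'e \<Rightarrow> 'k rel"
  assumes wf: "wf_digraph D" and con: "connected D" and c: "capacity D c"
    and ne: "{B. source_sink_dicut D B \<and> finite_capacity c B} \<noteq> {}"
  shows "woodall_wrt D {B. source_sink_dicut D B \<and> finite_capacity c B} c"
proof -
  let ?\<BB> = "{B. source_sink_dicut D B \<and> finite_capacity c B}"
  define units where "units A = (SIGMA e : A. Field (c e))" for A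
  have cap: "cap c A = |units A|" for A by (simp add: cap_eq_card_of units_def)
  then have fincap: "finite_capacity c A \<longleftrightarrow> finite (units A)" for A
    by (simp add: finite_capacity_def Field_card_of)
  have "\<exists>B. B \<in> ?\<BB>" using ne by blast
  then obtain B where B: "B \<in> ?\<BB>" and min: "\<And>B'. B' \<in> ?\<BB> \<Longrightarrow> card (units B) \<le> card (units B')"
    using ex_has_least_nat[of "\<lambda>B. B \<in> ?\<BB>" _ "\<lambda>B. card (units B)"] by blast
  define I where "I = units B"
  have finI: "finite I" using B by (simp add: I_def fincap)
  have arcs: "B' \<subseteq> arcs D" if "source_sink_dicut D B'" for B'
    using that dicut_subset_arcs by (auto simp: source_sink_dicut_def)
  have copies: "{x \<in> units (arcs D). fst x \<in> B'} = units B'" if "source_sink_dicut D B'" for B'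
    using arcs[OF that] by (auto simp: units_def)
  have "\<exists>col :: 'e \<times> 'k \<Rightarrow> nat. \<forall>B'. source_sink_dicut D B' \<and> finite {x \<in> units (arcs D). fst x \<in> B'} \<longrightarrow>
      {..<card I} \<subseteq> col ` {x \<in> units (arcs D). fst x \<in> B'}"
    by (rule source_sink_dicut_colouring[OF wf con])
      (use min copies in \<open>auto simp: I_def fincap units_def\<close>)
  then obtain col :: "'e \<times> 'k \<Rightarrow> nat" where sees:
    "\<forall>B'. source_sink_dicut D B' \<and> finite {x \<in> units (arcs D). fst x \<in> B'} \<longrightarrow>
      {..<card I} \<subseteq> col ` {x \<in> units (arcs D). fst x \<in> B'}" by (elim exE)
  have col: "{..<card I} \<subseteq> col ` units B'" if "B' \<in> ?\<BB>" for B'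
    using spec[OF sees, of B'] that copies[of B'] by (simp add: fincap)
  obtain g where g: "bij_betw g I {..<card I}"
    using finite_same_card_bij[OF finI, of "{..<card I}"] by auto
  define F where "F i = {e \<in> arcs D. \<exists>y\<in>Field (c e). col (e, y) = g i}" for i
  have "c_disjoint_dijoins D ?\<BB> c I F"
    unfolding c_disjoint_dijoins_def c_disjoint_def
  proof (intro conjI ballI)
    fix i assume i: "i \<in> I"
    have "F i \<inter> B' \<noteq> {}" if B': "B' \<in> ?\<BB>" for B'
    proof -
      have "g i < card I" using i g by (auto simp: bij_betw_def)
      then have "g i \<in> col ` units B'" using subsetD[OF col[OF B']] by simp
      then obtain e y where e: "e \<in> B'" "y \<in> Field (c e)" "col (e, y) = g i"
        by (auto simp: units_def)
      moreover have "e \<in> arcs D" using e(1) arcs[of B'] B' by auto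
      ultimately have "e \<in> F i \<inter> B'" by (auto simp: F_def)
      then show ?thesis by blast
    qed
    then show "dijoin D ?\<BB> (F i)" by (auto simp: dijoin_def F_def)
  next
    fix e assume e: "e \<in> arcs D"
    have "\<forall>i\<in>{i\<in>I. e \<in> F i}. \<exists>y. y \<in> Field (c e) \<and> col (e, y) = g i" by (auto simp: F_def)
    then obtain y where y: "\<And>i. i \<in> {i\<in>I. e \<in> F i} \<Longrightarrow> y i \<in> Field (c e) \<and> col (e, y i) = g i" by metis
    have "inj_on y {i\<in>I. e \<in> F i}"
    proof (rule inj_onI)
      fix i j assume ij: "i \<in> {i\<in>I. e \<in> F i}" "j \<in> {i\<in>I. e \<in> F i}" "y i = y j"
      then have "g i = g j" using y[OF ij(1)] y[OF ij(2)] by simp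
      then show "i = j" using ij bij_betw_imp_inj_on[OF g] by (auto dest: inj_onD)
    qed
    moreover have "y ` {i\<in>I. e \<in> F i} \<subseteq> Field (c e)" using y by blast
    ultimately have "|{i\<in>I. e \<in> F i}| \<le>o |Field (c e)|"
      using card_of_ordLeq[of "{i\<in>I. e \<in> F i}" "Field (c e)"] by blast
    moreover have "|Field (c e)| =o c e" using c e by (intro card_of_Field_ordIso) (simp add: capacity_def)
    ultimately show "|{i\<in>I. e \<in> F i}| \<le>o c e" by (rule ordLeq_ordIso_trans)
  qed
  moreover have "|I'| \<le>o |I|" if fam: "c_disjoint_dijoins D ?\<BB> c I' F'" for I' :: "('e \<times> 'k) set" and F'
  proof -
    obtain J :: "('e \<times> 'k) set" and f where J: "J \<subseteq> Field (cap c B)" "bij_betw f J I'"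
      using c_disjoint_dijoins_reindex[OF c B fam] by blast
    have "|I'| =o |J|" using J(2) card_of_ordIso[of J I'] ordIso_symmetric by blast
    moreover have "J \<subseteq> I" using J(1) by (simp add: cap Field_card_of I_def)
    then have "|J| \<le>o |I|" by (rule card_of_mono1)
    ultimately show ?thesis by (rule ordIso_ordLeq_trans)
  qed
  moreover have "cap c B \<le>o cap c B'" if "B' \<in> ?\<BB>" for B'
    unfolding cap using B that min by (intro card_of_le_finite) (auto simp: fincap)
  moreover have "cap c B =o |I|" unfolding cap I_def by (rule card_of_refl)
  ultimately show ?thesis unfolding woodall_wrt_def using B by blast
qed

theorem corollary6p10:
  fixes D :: "('v,'e) pre_digraph"
  assumes "loopfree_digraph D" and "connected D"
  shows "({B. source_sink_dicut D B \<and> finite B} \<noteq> {} \<longrightarrow>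
            woodall D {B. source_sink_dicut D B \<and> finite B}) \<and>
         (\<forall>c :: 'e \<Rightarrow> 'k rel.
            capacity D c \<and> {B. source_sink_dicut D B \<and> finite_capacity c B} \<noteq> {} \<longrightarrow>
            woodall_wrt D {B. source_sink_dicut D B \<and> finite_capacity c B} c)"
proof -
  interpret loopfree_digraph D by fact
  show ?thesis
    using woodall_source_sink[OF wf_digraph assms(2)] woodall_wrt_source_sink[OF wf_digraph assms(2)]
    by blast
qed

end
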